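(* Let $p\ge 3$ be an odd integer. There is a map $\phi:\mathcal{C}\to\rho$, given by $$(a,b,t)\longmapsto \left\{\begin{bmatrix}(t-b)/2& a\\ a& (t+b)/2\end{bmatrix}\right\}_{\Gamma_p},$$ for which every fiber has two elements.
   Context: For an integer $p\ge 3$ let $\lambda_p=2\cos(\pi/p)$. The Hecke group $\Gamma_p\subset \mathrm{PSL}(2,\mathbb{R})$ is generated by $\iota: z\mapsto -1/z$ and $\alpha_p: z\mapsto z+\lambda_p$. An element $g\in\Gamma_p$ is reciprocal if there is $h\in\Gamma_p$ with $g^{-1}=hgh^{-1}$. An involution is an element with $h^2=1$. $\rho$ is the set of conjugacy classes in $\Gamma_p$ of reciprocal elements other than the involution classes, and $\{\gamma\}_{\Gamma_p}$ denotes the conjugacy class of $\gamma$ in $\Gamma_p$. Pseudo-Euclidean algorithm: for $x,y\in\mathbb{Z}[\lambda_p]$, $y\neq0$, there is an integer $n$ with $x=y(n\lambda_p)+r$ and $-|y\lambda_p|/2\le r\le |y\lambda_p|/2$. Repeat: $x=y(n_0\lambda_p)+r_1$, $y=r_1(n_1\lambda_p)+r_2$, $\dots$, $r_{k-1}=r_k(n_k\lambda_p)+r_{k+1}$, $\dots$ (with $r_0=y$). If the algorithm terminates, i.e. $r_{k+1}=0$ for some $k$, then $(x,y)_p:=|r_k|$ for the first such $k$. $\mathcal{C}$ is the set of $(a,b,t)\in\mathbb{Z}[\lambda_p]^3$ such that $a,t>0$; with $d=4a^2+b^2$ one has $t^2-d=4$; and $\left(\tfrac{t-b}{2},a\right)_p=\left(\tfrac{t+b}{2},a\right)_p=1$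 (in particular $(t\pm b)/2\in\mathbb{Z}[\lambda_p]$). *)

theory Defs
  imports
    "HOL-Analysis.Analysis"
    "HOL-Algebra.Coset"
    "HOL-Algebra.Generated_Groups"
    "HOL-Computational_Algebra.Polynomial"
begin

definition hecke_lambda :: "nat \<Rightarrow> real" where
  "hecke_lambda p = 2 * cos (pi / real p)"

text \<open>The subring \<open>\<int>[\<lambda>\<^sub>p]\<close> of the reals.\<close>

definition Z_lambda :: "nat \<Rightarrow> real set" where
  "Z_lambda p = range (\<lambda>f :: int poly. poly (map_poly of_int f) (hecke_lambda p))"

definition mat2 :: "real \<Rightarrow> real \<Rightarrow> real \<Rightarrow> real \<Rightarrow> real^2^2" where
  "mat2 a b c d = vector [vector [a, b], vector [c, d]]"

definition SL2R :: "(real^2^2) monoid" where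
  "SL2R = \<lparr>carrier = {A. det A = 1}, mult = (**), one = mat 1\<rparr>"

definition PSL2R :: "(real^2^2) set monoid" where
  "PSL2R = SL2R Mod {mat 1, - mat 1}"

text \<open>The class \<open>{A, -A}\<close> of a matrix, as an element of \<^const>\<open>PSL2R\<close> when \<open>det A = 1\<close>.\<close>

definition psl :: "real^2^2 \<Rightarrow> (real^2^2) set" where
  "psl A = {mat 1, - mat 1} #>\<^bsub>SL2R\<^esub> A"

text \<open>The generators act on the upper half plane as \<open>z \<mapsto> -1/z\<close> and \<open>z \<mapsto> z + \<lambda>\<^sub>p\<close>.\<close>

definition Hecke :: "nat \<Rightarrow> (real^2^2) set monoid" where
  "Hecke p = PSL2R\<lparr>carrier :=
     generate PSL2R {psl (mat2 0 (-1) 1 0), psl (mat2 1 (hecke_lambda p) 0 1)}\<rparr>"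

definition conj_class :: "('a, 'b) monoid_scheme \<Rightarrow> 'a \<Rightarrow> 'a set" where
  "conj_class G g = {h \<otimes>\<^bsub>G\<^esub> g \<otimes>\<^bsub>G\<^esub> inv\<^bsub>G\<^esub> h | h. h \<in> carrier G}"

definition reciprocal :: "('a, 'b) monoid_scheme \<Rightarrow> 'a \<Rightarrow> bool" where
  "reciprocal G g \<longleftrightarrow>
     g \<in> carrier G \<and> (\<exists>h \<in> carrier G. inv\<^bsub>G\<^esub> g = h \<otimes>\<^bsub>G\<^esub> g \<otimes>\<^bsub>G\<^esub> inv\<^bsub>G\<^esub> h)"

text \<open>The identity counts as an involution.\<close>

definition involution :: "('a, 'b) monoid_scheme \<Rightarrow> 'a \<Rightarrow> bool" where
  "involution G h \<longleftrightarrow> h \<in> carrier G \<and> h \<otimes>\<^bsub>G\<^esub> h = \<one>\<^bsub>G\<^esub>"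

definition reciprocal_classes :: "nat \<Rightarrow> (real^2^2) set set set" where
  "reciprocal_classes p =
     {conj_class (Hecke p) g | g. reciprocal (Hecke p) g \<and> \<not> involution (Hecke p) g}"

text \<open>
  \<open>pseudo_gcd p x y d\<close> says that the pseudo-Euclidean algorithm started at \<open>x, y\<close> terminates and
  \<open>(x, y)\<^sub>p = d\<close>. A quotient is not unique when the remainder is \<open>\<plusminus>\<bar>y \<lambda>\<^sub>p\<bar> / 2\<close>, but then only the
  sign of the remainder is affected, so \<open>d\<close> does not depend on the choices
  (lemma \<open>pseudo_gcd_unique\<close> below).
\<close>

inductive pseudo_gcd :: "nat \<Rightarrow> real \<Rightarrow> real \<Rightarrow> real \<Rightarrow> bool" for p where
  stop: "\<lbrakk>y \<noteq> 0; x = y * (of_int n * hecke_lambda p)\<rbrakk> \<Longrightarrow> pseudo_gcd p x y \<bar>y\<bar>"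
| step: "\<lbrakk>y \<noteq> 0; x = y * (of_int n * hecke_lambda p) + r; r \<noteq> 0;
          - \<bar>y * hecke_lambda p\<bar> / 2 \<le> r; r \<le> \<bar>y * hecke_lambda p\<bar> / 2;
          pseudo_gcd p y r d\<rbrakk> \<Longrightarrow> pseudo_gcd p x y d"

text \<open>Smallest remainders modulo \<open>L\<close> of two numbers equal up to sign are equal up to sign.\<close>

lemma remainder_abs_unique:
  fixes L r r' :: real and n n' :: int
  assumes L: "L \<noteq> 0"
    and abs: "\<bar>of_int n * L + r\<bar> = \<bar>of_int n' * L + r'\<bar>"
    and r: "\<bar>r\<bar> \<le> \<bar>L\<bar> / 2" and r': "\<bar>r'\<bar> \<le> \<bar>L\<bar> / 2"
  shows "\<bar>r\<bar> = \<bar>r'\<bar>"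
proof -
  have main: "\<bar>r\<bar> = \<bar>s\<bar>" if eq: "of_int n * L + r = of_int m * L + s" and s: "\<bar>s\<bar> \<le> \<bar>L\<bar> / 2"
    for m :: int and s :: real
  proof -
    have d: "of_int (m - n) * L = r - s" using eq by (simp add: algebra_simps)
    have ab: "\<bar>of_int (m - n)\<bar> * \<bar>L\<bar> = \<bar>r - s\<bar>" by (simp only: d[symmetric] abs_mult)
    consider "m = n" | "\<bar>m - n\<bar> = 1" | "\<bar>m - n\<bar> \<ge> 2" by linarith
    then show ?thesis
    proof cases
      case 1 then show ?thesis using d by simp
    next
      case 2
      then have "\<bar>real_of_int (m - n)\<bar> = 1" by linarith
      then have "\<bar>L\<bar> = \<bar>r - s\<bar>" using ab by simp
      then show ?thesis using r s by linarith
    next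
      case 3
      then have "\<bar>real_of_int (m - n)\<bar> \<ge> 2" by linarith
      then have "2 * \<bar>L\<bar> \<le> \<bar>r - s\<bar>" using ab by (metis abs_ge_zero mult_right_mono)
      then show ?thesis using r s L by linarith
    qed
  qed
  consider "of_int n * L + r = of_int n' * L + r'" | "of_int n * L + r = of_int (- n') * L + (- r')"
    using abs by (auto simp: abs_eq_iff)
  then show ?thesis
  proof cases
    case 1 then show ?thesis using main r' by blast
  next
    case 2 then show ?thesis using main[of "- n'" "- r'"] r' by simp
  qed
qed

lemma pseudo_gcd_abs_unique:
  assumes p: "p \<ge> 3"
  shows "pseudo_gcd p x y d \<Longrightarrow> pseudo_gcd p x' y' d' \<Longrightarrow> \<bar>x\<bar> = \<bar>x'\<bar> \<Longrightarrow> \<bar>y\<bar> = \<bar>y'\<bar> \<Longrightarrow> d = d'"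
proof -
  let ?l = "hecke_lambda p"
  have "pi / real p < pi / 2" using p by (intro divide_strict_left_mono) auto
  then have l: "?l > 0"
    unfolding hecke_lambda_def using p by (simp add: cos_gt_zero)
  have key: "\<bar>r\<bar> = \<bar>r'\<bar>"
    if h: "y \<noteq> 0" "\<bar>y\<bar> = \<bar>y'\<bar>" "\<bar>y * (of_int n * ?l) + r\<bar> = \<bar>y' * (of_int n' * ?l) + r'\<bar>"
       "\<bar>r\<bar> \<le> \<bar>y * ?l\<bar> / 2" "\<bar>r'\<bar> \<le> \<bar>y' * ?l\<bar> / 2"
    for y y' r r' :: real and n n' :: int
  proof -
    have "\<exists>m :: int. y' * of_int n' = y * of_int m"
    proof (cases "y' = y")
      case False
      then have "y' * of_int n' = y * of_int (- n')" using h(2) by (auto simp: abs_eq_iff)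
      then show ?thesis ..
    qed auto
    then obtain m :: int where m: "y' * of_int n' = y * of_int m" ..
    have "y' * (of_int n' * ?l) = y * of_int m * ?l"
      unfolding m[symmetric] by (simp only: mult.assoc)
    then have "\<bar>of_int n * (y * ?l) + r\<bar> = \<bar>of_int m * (y * ?l) + r'\<bar>"
      using h(3) by (simp only: ac_simps)
    then show ?thesis
      using remainder_abs_unique[of "y * ?l" n r m r'] h l by (simp add: abs_mult)
  qed
  show "pseudo_gcd p x y d \<Longrightarrow> pseudo_gcd p x' y' d' \<Longrightarrow> \<bar>x\<bar> = \<bar>x'\<bar> \<Longrightarrow> \<bar>y\<bar> = \<bar>y'\<bar> \<Longrightarrow> d = d'"
  proof (induction arbitrary: x' y' d' rule: pseudo_gcd.induct)
    case (stop y x n)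
    show ?case using stop.prems(1)
    proof cases
      case (stop n') then show ?thesis using \<open>\<bar>y\<bar> = \<bar>y'\<bar>\<close> by simp
    next
      case (step n' r')
      have 1: "\<bar>r'\<bar> \<le> \<bar>y' * ?l\<bar> / 2" using step(4,5) by (intro abs_leI) simp_all
      have 2: "\<bar>y * (of_int n * ?l) + 0\<bar> = \<bar>y' * (of_int n' * ?l) + r'\<bar>"
        using stop.prems(2) unfolding stop.hyps(2) step(2) add_0_right .
      have "\<bar>0::real\<bar> = \<bar>r'\<bar>"
        using key[OF stop.hyps(1) stop.prems(3) 2 _ 1] by simp
      then show ?thesis using step by simp
    qed
  next
    case (step y x n r d)
    show ?case using step.prems(1)
    proof cases
      case (stop n')
      have 1: "\<bar>r\<bar> \<le> \<bar>y * ?l\<bar> / 2" using step.hyps(4,5) by (intro abs_leI) simp_all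
      have 2: "\<bar>y * (of_int n * ?l) + r\<bar> = \<bar>y' * (of_int n' * ?l) + 0\<bar>"
        using step.prems(2) unfolding step.hyps(2) stop(3) add_0_right .
      have "\<bar>r\<bar> = \<bar>0::real\<bar>"
        using key[OF step.hyps(1) step.prems(3) 2 1] by simp
      then show ?thesis using step.hyps by simp
    next
      case inner: (step n' r')
      have 1: "\<bar>r\<bar> \<le> \<bar>y * ?l\<bar> / 2" using step.hyps(4,5) by (intro abs_leI) simp_all
      have 2: "\<bar>r'\<bar> \<le> \<bar>y' * ?l\<bar> / 2" using inner(4,5) by (intro abs_leI) simp_all
      have 3: "\<bar>y * (of_int n * ?l) + r\<bar> = \<bar>y' * (of_int n' * ?l) + r'\<bar>"
        using step.prems(2) unfolding step.hyps(2) inner(2) .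
      have "\<bar>r\<bar> = \<bar>r'\<bar>"
        by (rule key[OF step.hyps(1) step.prems(3) 3 1 2])
      then show ?thesis using inner step.IH step.prems by blast
    qed
  qed
qed

lemma pseudo_gcd_unique:
  assumes "p \<ge> 3" "pseudo_gcd p x y d" "pseudo_gcd p x y d'"
  shows "d = d'"
  using pseudo_gcd_abs_unique[OF assms] by simp

definition reciprocal_triples :: "nat \<Rightarrow> (real \<times> real \<times> real) set" where
  "reciprocal_triples p =
     {(a, b, t). a \<in> Z_lambda p \<and> b \<in> Z_lambda p \<and> t \<in> Z_lambda p \<and> a > 0 \<and> t > 0 \<and>
        t\<^sup>2 - (4 * a\<^sup>2 + b\<^sup>2) = 4 \<and>
        (t - b) / 2 \<in> Z_lambda p \<and> (t + b) / 2 \<in> Z_lambda p \<and>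
        pseudo_gcd p ((t - b) / 2) a 1 \<and> pseudo_gcd p ((t + b) / 2) a 1}"

end

theory Submission
  imports Defs
begin

text \<open>
  The proof works in the group \<open>G \<subseteq> SL(2,\<real>)\<close> of all matrices over \<open>\<Gamma>\<^sub>p\<close>, with
  \<open>S = (0, -1; 1, 0)\<close>, \<open>U\<^sup>x = (1, x; 0, 1)\<close> and \<open>\<lambda> = \<lambda>\<^sub>p\<close>. A matrix \<open>M\<close> of determinant \<open>1\<close>
  is symmetric if and only if \<open>S M S\<inverse> = M\<inverse>\<close>. So symmetric matrices in \<open>G\<close> are reciprocal, and the
  theorem says that every reciprocal class contains exactly two symmetric matrices with positive
  trace and positive off-diagonal entry.

  \<^bold>\<open>The arithmetic input.\<close> All of it comes from one fact (\<open>G_entry_gap\<close>): an entry of a matrix in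
  \<open>G\<close> is \<open>0\<close> or has absolute value at least \<open>1\<close>. Up to sign and up to factors \<open>S\<close> on both sides,
  each matrix in \<open>G\<close> is a product of matrices \<open>V\<^sub>j\<close>, \<open>1 \<le> j < p\<close>, whose entries lie in
  \<open>{0} \<union> [1, \<infinity>)\<close>, and this set is closed under addition and multiplication. The gap makes the
  pseudo-Euclidean algorithm terminate on the columns of \<open>G\<close>, because each remainder is at most
  \<open>\<lambda>/2 < 1\<close> times the previous one in absolute value. Hence \<open>(x, y)\<^sub>p = 1\<close> says precisely that
  \<open>y \<noteq> 0\<close> and that \<open>(x, y)\<close> is a column of a matrix in \<open>G\<close>. A matrix of determinant \<open>1\<close> with
  both columns of this kind lies in \<open>G\<close> (\<open>G_if_columns\<close>). For symmetric matrices this turns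
  membership in \<open>G\<close> into the two conditions in the definition of \<open>\<C>\<close> (\<open>symmetric_in_G_iff\<close>),
  so triples correspond to normalized symmetric matrices.

  \<^bold>\<open>Surjectivity.\<close> If \<open>h\<close> conjugates \<open>g\<close> to its inverse and \<open>g\<close> is not an involution, then \<open>h\<close> has
  trace \<open>0\<close>, so it has order \<open>2\<close>. For odd \<open>p\<close> every element of \<open>\<Gamma>\<^sub>p\<close> of order \<open>2\<close> is conjugate to \<open>S\<close>
  (\<open>involution_conj_S\<close>): the nontrivial case is \<open>S W\<close> with a symmetric word \<open>W\<close> in the \<open>V\<^sub>j\<close>, and
  as transposition maps \<open>V\<^sub>j\<close> to \<open>V\<^bsub>p - j\<^esub>\<close>, such a word has no middle letter and is of the form
  \<open>K K\<^sup>T\<close>. Conjugating \<open>h\<close> to \<open>S\<close> makes \<open>g\<close> symmetric.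

  \<^bold>\<open>Fibres.\<close> Let \<open>M\<^sub>0\<close> be a normalized symmetric matrix. If \<open>k M\<^sub>0 k\<inverse>\<close> is symmetric, then
  \<open>k\<inverse> S k\<close> inverts \<open>M\<^sub>0\<close>, so it is \<open>X S\<close> for some \<open>X\<close> in the centralizer of \<open>M\<^sub>0\<close>. Replacing
  \<open>k\<close> by \<open>k Z\<close> with \<open>Z\<close> in the centralizer multiplies \<open>X\<close> by \<open>Z\<^sup>-\<^sup>2\<close>. Up to sign the centralizer is
  infinite cyclic, by the entry gap, so it has exactly two classes modulo squares
  (\<open>cent_mod_squares\<close>), and each class gives one normalized symmetric matrix
  (\<open>two_symmetric_conjugates\<close>).
\<close>

section \<open>Two by two matrices\<close>

text \<open>The inverse of a matrix of determinant \<open>1\<close>, in a form that is polynomial in the entries, so that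
identities between inverses become ring identities.\<close>

definition adj2 :: "real^2^2 \<Rightarrow> real^2^2" where
  "adj2 A = mat2 (A$2$2) (- (A$1$2)) (- (A$2$1)) (A$1$1)"

lemma mat2_nth [simp]:
  "mat2 a b c d $ 1 $ 1 = a" "mat2 a b c d $ 1 $ 2 = b"
  "mat2 a b c d $ 2 $ 1 = c" "mat2 a b c d $ 2 $ 2 = d"
  by (simp_all add: mat2_def)

lemma mat2_eta: "mat2 (A$1$1) (A$1$2) (A$2$1) (A$2$2) = A"
  by (simp add: vec_eq_iff forall_2)

lemma mat2_cases: obtains a b c d where "A = mat2 a b c d"
  using mat2_eta[of A] by metis

lemma mat2_eq_iff [simp]:
  "mat2 a b c d = mat2 a' b' c' d' \<longleftrightarrow> a = a' \<and> b = b' \<and> c = c' \<and> d = d'"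
  by (metis mat2_nth)

lemma mat2_mult [simp]:
  "mat2 a b c d ** mat2 a' b' c' d'
     = mat2 (a * a' + b * c') (a * b' + b * d') (c * a' + d * c') (c * b' + d * d')"
  by (simp add: vec_eq_iff forall_2 matrix_matrix_mult_def sum_2)

lemma uminus_mat2 [simp]: "- mat2 a b c d = mat2 (- a) (- b) (- c) (- d)"
  by (simp add: vec_eq_iff forall_2)

lemma det_mat2 [simp]: "det (mat2 a b c d) = a * d - b * c"
  by (simp add: det_2)

lemma mat_1_mat2: "mat 1 = mat2 1 0 0 1"
  by (simp add: vec_eq_iff forall_2 mat_def)

lemma transpose_mat2 [simp]: "transpose (mat2 a b c d) = mat2 a c b d"
  by (simp add: vec_eq_iff forall_2 transpose_def)

lemma adj2_mat2 [simp]: "adj2 (mat2 a b c d) = mat2 d (- b) (- c) a"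
  by (simp add: adj2_def)

lemma matrix_neg_left [simp]: "(- A) ** B = - ((A :: real^2^2) ** (B :: real^2^2))"
  by (cases A rule: mat2_cases; cases B rule: mat2_cases) simp

lemma matrix_neg_right [simp]: "A ** (- B) = - ((A :: real^2^2) ** (B :: real^2^2))"
  by (cases A rule: mat2_cases; cases B rule: mat2_cases) simp

lemma adj2_mult: "adj2 (A ** B) = adj2 B ** adj2 A"
  by (cases A rule: mat2_cases; cases B rule: mat2_cases) simp

lemma adj2_adj2 [simp]: "adj2 (adj2 A) = A"
  by (cases A rule: mat2_cases) simp

lemma adj2_uminus [simp]: "adj2 (- A) = - adj2 A"
  by (cases A rule: mat2_cases) simp

lemma adj2_one [simp]: "adj2 (mat 1) = mat 1"
  by (simp add: mat_1_mat2)

lemma det_adj2 [simp]: "det (adj2 A) = det A"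
  by (cases A rule: mat2_cases) simp

lemma det_uminus2 [simp]: "det (- A) = det (A :: real^2^2)"
  by (cases A rule: mat2_cases) simp

lemma adj2_right_inverse: "det A = 1 \<Longrightarrow> A ** adj2 A = mat 1"
  by (cases A rule: mat2_cases) (simp add: mat_1_mat2 algebra_simps)

lemma adj2_left_inverse: "det A = 1 \<Longrightarrow> adj2 A ** A = mat 1"
  by (cases A rule: mat2_cases) (simp add: mat_1_mat2 algebra_simps)

lemma adj2_cancel:
  assumes "det A = 1"
  shows "X ** A ** adj2 A = X" "X ** adj2 A ** A = X"
    "A ** (adj2 A ** X) = X" "adj2 A ** (A ** X) = X"
  using assms
  by (simp_all add: matrix_mul_assoc[symmetric] adj2_right_inverse adj2_left_inverse)
     (simp_all add: matrix_mul_assoc adj2_right_inverse adj2_left_inverse)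

lemma trace_mat2 [simp]: "trace (mat2 a b c d) = a + d"
  by (simp add: trace_def sum_2)

lemma trace_conj:
  fixes X :: "real^2^2"
  assumes "det X = 1"
  shows "trace (X ** A ** adj2 X) = trace A"
  by (metis assms adj2_cancel(4) matrix_mul_assoc trace_mul_sym)

section \<open>The special linear group and its quotient\<close>

lemma group_SL2R: "group SL2R"
proof (rule groupI)
  fix A assume "A \<in> carrier SL2R"
  then have "adj2 A \<in> carrier SL2R \<and> adj2 A \<otimes>\<^bsub>SL2R\<^esub> A = \<one>\<^bsub>SL2R\<^esub>"
    by (simp add: SL2R_def adj2_left_inverse)
  then show "\<exists>B\<in>carrier SL2R. B \<otimes>\<^bsub>SL2R\<^esub> A = \<one>\<^bsub>SL2R\<^esub>" by blast
qed (auto simp: SL2R_def det_mul matrix_mul_assoc)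

lemma SL2R_simps:
  "carrier SL2R = {A. det A = 1}" "A \<otimes>\<^bsub>SL2R\<^esub> B = A ** B" "\<one>\<^bsub>SL2R\<^esub> = mat 1"
  by (simp_all add: SL2R_def)

lemma inv_SL2R: "det A = 1 \<Longrightarrow> inv\<^bsub>SL2R\<^esub> A = adj2 A"
  using group.inv_equality[OF group_SL2R, of "adj2 A" A]
  by (simp add: SL2R_simps adj2_left_inverse)

lemma center_normal: "{mat 1, - mat 1} \<lhd> SL2R"
proof (rule group.normal_invI[OF group_SL2R])
  show "subgroup {mat 1, - mat 1} SL2R"
    by (rule group.subgroupI[OF group_SL2R]) (auto simp: SL2R_simps inv_SL2R)
  fix X h :: "real^2^2" assume "X \<in> carrier SL2R" "h \<in> {mat 1, - mat 1}"
  then show "X \<otimes>\<^bsub>SL2R\<^esub> h \<otimes>\<^bsub>SL2R\<^esub> inv\<^bsub>SL2R\<^esub> X \<in> {mat 1, - mat 1}"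
    by (auto simp: SL2R_simps inv_SL2R adj2_right_inverse)
qed

text \<open>A class modulo the centre is an unordered pair of opposite matrices, which reduces every question
about \<^const>\<open>PSL2R\<close> to one about matrices up to sign.\<close>

lemma psl_eq: "psl A = {A, - A}"
  by (auto simp: psl_def r_coset_def SL2R_simps)

lemma psl_eq_iff: "psl A = psl B \<longleftrightarrow> A = B \<or> A = - B"
  by (auto simp: psl_eq doubleton_eq_iff)

lemma group_PSL2R: "group PSL2R"
  unfolding PSL2R_def by (rule normal.factorgroup_is_group[OF center_normal])

lemma psl_hom: "psl \<in> hom SL2R PSL2R"
  using normal.r_coset_hom_Mod[OF center_normal] unfolding PSL2R_def psl_def .

lemma psl_mult:
  "det A = 1 \<Longrightarrow> det B = 1 \<Longrightarrow> psl A \<otimes>\<^bsub>PSL2R\<^esub> psl B = psl (A ** B)"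
  using hom_mult[OF psl_hom, of A B] by (simp add: SL2R_simps)

lemma psl_carrier: "det A = 1 \<Longrightarrow> psl A \<in> carrier PSL2R"
  using hom_in_carrier[OF psl_hom, of A] by (simp add: SL2R_simps)

lemma psl_one: "psl (mat 1) = \<one>\<^bsub>PSL2R\<^esub>"
  using hom_one[OF psl_hom group_SL2R group_PSL2R] by (simp add: SL2R_simps)

section \<open>The Hecke group as a group of matrices\<close>

abbreviation S2 :: "real^2^2" where "S2 \<equiv> mat2 0 (- 1) 1 0"
abbreviation U2 :: "real \<Rightarrow> real^2^2" where "U2 x \<equiv> mat2 1 x 0 1"

text \<open>The full preimage of \<open>\<Gamma>\<^sub>p\<close> in \<open>SL(2,\<real>)\<close>: it contains \<open>- 1\<close> because \<open>S\<^sup>2 = - 1\<close>.\<close>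

definition hecke_mats :: "nat \<Rightarrow> (real^2^2) set" where
  "hecke_mats p = generate SL2R {S2, U2 (hecke_lambda p)}"

lemma hecke_mats_gens: "{S2, U2 (hecke_lambda p)} \<subseteq> carrier SL2R"
  by (simp add: SL2R_simps)

lemma hecke_mats_subgroup: "subgroup (hecke_mats p) SL2R"
  unfolding hecke_mats_def
  by (rule group.generate_is_subgroup[OF group_SL2R hecke_mats_gens])

lemma hecke_mats_det: "A \<in> hecke_mats p \<Longrightarrow> det A = 1"
  using subgroup.mem_carrier[OF hecke_mats_subgroup] by (simp add: SL2R_simps)

lemma hecke_mats_mult:
  "A \<in> hecke_mats p \<Longrightarrow> B \<in> hecke_mats p \<Longrightarrow> A ** B \<in> hecke_mats p"
  using subgroup.m_closed[OF hecke_mats_subgroup, of A p B] by (simp add: SL2R_simps)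

lemma hecke_mats_one: "mat 1 \<in> hecke_mats p"
  using subgroup.one_closed[OF hecke_mats_subgroup] by (simp add: SL2R_simps)

lemma hecke_mats_adj: "A \<in> hecke_mats p \<Longrightarrow> adj2 A \<in> hecke_mats p"
  using subgroup.m_inv_closed[OF hecke_mats_subgroup] by (metis hecke_mats_det inv_SL2R)

lemma S2_in_hecke_mats: "S2 \<in> hecke_mats p"
  unfolding hecke_mats_def by (intro generate.incl) simp

lemma U2_in_hecke_mats: "U2 (hecke_lambda p) \<in> hecke_mats p"
  unfolding hecke_mats_def by (intro generate.incl) simp

lemma hecke_mats_uminus: "A \<in> hecke_mats p \<Longrightarrow> - A \<in> hecke_mats p"
proof -
  assume A: "A \<in> hecke_mats p"
  have "S2 ** S2 ** A \<in> hecke_mats p" by (intro hecke_mats_mult S2_in_hecke_mats A)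
  moreover have "S2 ** S2 ** A = - A" by (cases A rule: mat2_cases) simp
  ultimately show ?thesis by simp
qed

lemma U2_int_in_hecke_mats: "U2 (of_int n * hecke_lambda p) \<in> hecke_mats p"
proof -
  have nat: "U2 (real k * hecke_lambda p) \<in> hecke_mats p" for k
  proof (induction k)
    case 0
    then show ?case using hecke_mats_one by (simp add: mat_1_mat2)
  next
    case (Suc k)
    have "U2 (real k * hecke_lambda p) ** U2 (hecke_lambda p) \<in> hecke_mats p"
      by (intro hecke_mats_mult Suc U2_in_hecke_mats)
    then show ?case by (simp add: algebra_simps)
  qed
  show ?thesis
  proof (cases "n \<ge> 0")
    case True
    then show ?thesis using nat[of "nat n"] by simp
  next
    case False
    then show ?thesis using hecke_mats_adj[OF nat[of "nat (- n)"]] by simp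
  qed
qed

lemma hecke_mats_induct [consumes 1, case_names one S U S_inv U_inv mult]:
  assumes "A \<in> hecke_mats p"
    and "P (mat 1)" "P S2" "P (U2 (hecke_lambda p))" "P (- S2)" "P (U2 (- hecke_lambda p))"
    and "\<And>A B. A \<in> hecke_mats p \<Longrightarrow> P A \<Longrightarrow> B \<in> hecke_mats p \<Longrightarrow> P B \<Longrightarrow> P (A ** B)"
  shows "P A"
  using assms(1) unfolding hecke_mats_def
proof (induction rule: generate.induct)
  case (inv h)
  then have "inv\<^bsub>SL2R\<^esub> h = adj2 h" by (intro inv_SL2R) auto
  with inv assms show ?case by auto
qed (use assms in \<open>auto simp: SL2R_simps hecke_mats_def\<close>)

text \<open>
  This is conjugation by \<open>diag(1, -1)\<close>, the reflection \<open>z \<mapsto> - cnj z\<close> of the half plane. It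
  inverts both generators. As a consequence the relative sign of the two entries of a column is
  immaterial.
\<close>

lemma hecke_mats_reflect:
  "mat2 a b c d \<in> hecke_mats p \<Longrightarrow> mat2 a (- b) (- c) d \<in> hecke_mats p"
proof -
  define J where "J A = mat2 (A$1$1) (- (A$1$2)) (- (A$2$1)) (A$2$2)" for A :: "real^2^2"
  have "J A \<in> hecke_mats p" if "A \<in> hecke_mats p" for A
    using that
  proof (induction rule: hecke_mats_induct)
    case (mult A B)
    have "J (A ** B) = J A ** J B"
      by (cases A rule: mat2_cases; cases B rule: mat2_cases) (simp add: J_def)
    with mult show ?case by (simp add: hecke_mats_mult)
  next
    case one
    then show ?case using hecke_mats_one by (simp add: J_def mat_1_mat2)
  next
    case S
    then show ?case using hecke_mats_uminus[OF S2_in_hecke_mats] by (simp add: J_def)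
  next
    case S_inv
    then show ?case using S2_in_hecke_mats by (simp add: J_def)
  next
    case U
    then show ?case using hecke_mats_adj[OF U2_in_hecke_mats] by (simp add: J_def)
  next
    case U_inv
    then show ?case using U2_in_hecke_mats by (simp add: J_def)
  qed
  from this[of "mat2 a b c d"] show "mat2 a b c d \<in> hecke_mats p \<Longrightarrow> ?thesis"
    by (simp add: J_def)
qed

lemma Hecke_carrier: "carrier (Hecke p) = psl ` hecke_mats p"
proof -
  interpret group_hom SL2R PSL2R psl
    using group_SL2R group_PSL2R psl_hom by (simp add: group_hom_def group_hom_axioms_def)
  show ?thesis
    using generate_img[OF hecke_mats_gens, of p] by (simp add: Hecke_def hecke_mats_def)
qed

lemma Hecke_one: "\<one>\<^bsub>Hecke p\<^esub> = psl (mat 1)"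
  by (simp add: Hecke_def psl_one)

lemma Hecke_mult:
  "A \<in> hecke_mats p \<Longrightarrow> B \<in> hecke_mats p \<Longrightarrow> psl A \<otimes>\<^bsub>Hecke p\<^esub> psl B = psl (A ** B)"
  by (simp add: Hecke_def psl_mult hecke_mats_det)

lemma group_Hecke: "group (Hecke p)"
  unfolding Hecke_def
  by (rule group.subgroup_imp_group[OF group_PSL2R group.generate_is_subgroup[OF group_PSL2R]])
     (auto intro: psl_carrier)

lemma Hecke_inv: "A \<in> hecke_mats p \<Longrightarrow> inv\<^bsub>Hecke p\<^esub> (psl A) = psl (adj2 A)"
  by (rule group.inv_equality[OF group_Hecke])
     (simp_all add: Hecke_carrier Hecke_mult Hecke_one hecke_mats_adj adj2_left_inverse hecke_mats_det)

lemma Hecke_conj: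
  assumes "A \<in> hecke_mats p" "X \<in> hecke_mats p"
  shows "psl X \<otimes>\<^bsub>Hecke p\<^esub> psl A \<otimes>\<^bsub>Hecke p\<^esub> inv\<^bsub>Hecke p\<^esub> psl X = psl (X ** A ** adj2 X)"
  using assms by (simp add: Hecke_inv Hecke_mult hecke_mats_mult hecke_mats_adj)

lemma conj_class_psl:
  "A \<in> hecke_mats p \<Longrightarrow>
     conj_class (Hecke p) (psl A) = {psl (X ** A ** adj2 X) | X. X \<in> hecke_mats p}"
  by (auto simp: conj_class_def Hecke_carrier Hecke_conj) (metis Hecke_conj imageI)

lemma conj_class_psl_eq_iff:
  assumes A: "A \<in> hecke_mats p" and B: "B \<in> hecke_mats p"
  shows "conj_class (Hecke p) (psl A) = conj_class (Hecke p) (psl B) \<longleftrightarrow>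
    (\<exists>X\<in>hecke_mats p. A = X ** B ** adj2 X \<or> A = - (X ** B ** adj2 X))"
    (is "?L \<longleftrightarrow> ?R")
proof
  assume ?L
  moreover have "psl A \<in> conj_class (Hecke p) (psl A)"
    unfolding conj_class_psl[OF A] using hecke_mats_one by force
  ultimately show ?R unfolding conj_class_psl[OF B] psl_eq_iff[symmetric] by auto
next
  assume ?R
  then obtain X where X: "X \<in> hecke_mats p" and eq: "psl A = psl (X ** B ** adj2 X)"
    unfolding psl_eq_iff[symmetric] by blast
  have dX: "det X = 1" by (rule hecke_mats_det[OF X])
  have mem: "X ** B ** adj2 X \<in> hecke_mats p" by (intro hecke_mats_mult hecke_mats_adj X B)
  have 1: "Y ** (X ** B ** adj2 X) ** adj2 Y = (Y ** X) ** B ** adj2 (Y ** X)" for Y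
    by (simp add: adj2_mult matrix_mul_assoc)
  have 2: "Y ** B ** adj2 Y = (Y ** adj2 X) ** (X ** B ** adj2 X) ** adj2 (Y ** adj2 X)" for Y
    by (simp add: adj2_mult matrix_mul_assoc adj2_cancel[OF dX])
  show ?L unfolding eq conj_class_psl[OF mem] conj_class_psl[OF B]
  proof (intro equalityI subsetI; clarsimp)
    fix Y assume Y: "Y \<in> hecke_mats p"
    show "\<exists>Z. psl (Y ** (X ** B ** adj2 X) ** adj2 Y) = psl (Z ** B ** adj2 Z) \<and> Z \<in> hecke_mats p"
      using 1 hecke_mats_mult[OF Y X] by metis
    show "\<exists>Z. psl (Y ** B ** adj2 Y) = psl (Z ** (X ** B ** adj2 X) ** adj2 Z) \<and> Z \<in> hecke_mats p"
      using 2 hecke_mats_mult[OF Y hecke_mats_adj[OF X]] by metis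
  qed
qed

section \<open>Positive words and the entry gap\<close>

text \<open>In a regular \<open>p\<close>-gon of side \<open>1\<close> this is the length of a diagonal that spans \<open>j\<close> sides. It is also
the Chebyshev polynomial of the second kind of degree \<open>j - 1\<close> at \<open>cos (\<pi>/p)\<close>. Up to sign, the
entries of the powers of the elliptic matrix \<open>T = U S\<close>, which has trace \<open>\<lambda>\<close>, are of this form.\<close>

definition chord :: "nat \<Rightarrow> int \<Rightarrow> real" where
  "chord p j = sin (of_int j * (pi / real p)) / sin (pi / real p)"

text \<open>\<open>V\<^sub>j = - T\<^sup>j S\<close>, where \<open>T\<close> has order \<open>p\<close> modulo sign. The factor \<open>S\<close> makes all entries nonnegative
for \<open>0 < j < p\<close>: the columns of \<open>V\<^sub>j\<close> are neighbours in a subdivision of the first quadrant. The index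
is an integer because the boundary values \<open>V\<^sub>0 = - S\<close> and \<open>V\<^sub>p = S\<close> matter, and the former
contains a chord of index \<open>- 1\<close>.\<close>

definition Vmat :: "nat \<Rightarrow> int \<Rightarrow> real^2^2" where
  "Vmat p j = mat2 (chord p j) (chord p (j + 1)) (chord p (j - 1)) (chord p j)"

definition word :: "nat \<Rightarrow> int list \<Rightarrow> real^2^2" where
  "word p js = foldr (\<lambda>j X. Vmat p j ** X) js (mat 1)"

text \<open>The set \<open>{0} \<union> [1, \<infinity>)\<close> is closed under addition and multiplication, so this property passes to
products.\<close>

definition gap_mat :: "real^2^2 \<Rightarrow> bool" where
  "gap_mat A \<longleftrightarrow> (\<forall>i j. A $ i $ j = 0 \<or> A $ i $ j \<ge> 1)"

lemma word_simps [simp]: "word p [] = mat 1" "word p (j # js) = Vmat p j ** word p js"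
  by (simp_all add: word_def)

lemma word_append: "word p (js @ ks) = word p js ** word p ks"
  by (induction js) (simp_all add: matrix_mul_assoc)

lemma gap_mat_mult:
  assumes "gap_mat A" "gap_mat B"
  shows "gap_mat (A ** B)"
proof -
  have add: "x + y = 0 \<or> x + y \<ge> 1" if "x = 0 \<or> x \<ge> 1" "y = 0 \<or> y \<ge> 1" for x y :: real
    using that by auto
  have mul: "x * y = 0 \<or> x * y \<ge> 1" if "x = 0 \<or> x \<ge> 1" "y = 0 \<or> y \<ge> 1" for x y :: real
    using that mult_mono[of 1 x 1 y] by auto
  have "A $ i $ 1 * B $ 1 $ j + A $ i $ 2 * B $ 2 $ j = 0
      \<or> A $ i $ 1 * B $ 1 $ j + A $ i $ 2 * B $ 2 $ j \<ge> 1" for i j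
    using assms unfolding gap_mat_def by (intro add mul) blast+
  then show ?thesis
    by (simp add: gap_mat_def matrix_matrix_mult_def sum_2)
qed

locale hecke =
  fixes p :: nat
  assumes p3: "p \<ge> 3"
begin

abbreviation "lam \<equiv> hecke_lambda p"
abbreviation "G \<equiv> hecke_mats p"
abbreviation "s \<equiv> chord p"
abbreviation "V \<equiv> Vmat p"
abbreviation "T \<equiv> U2 lam ** S2"
abbreviation "letters \<equiv> {1..int p - 1}"

lemma pi_p_bounds: "0 < pi / real p" "pi / real p < pi"
  using p3 by (auto simp: field_simps)

lemma sin_pi_p_pos: "sin (pi / real p) > 0"
  by (intro sin_gt_zero pi_p_bounds)

lemma chord_0 [simp]: "s 0 = 0" and chord_1 [simp]: "s 1 = 1"
  and chord_p [simp]: "s (int p) = 0"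
  using sin_pi_p_pos p3 by (simp_all add: chord_def)

lemma chord_rec: "s (j + 1) + s (j - 1) = lam * s j"
proof -
  have "sin (x + y) + sin (x - y) = 2 * cos y * sin x" for x y :: real
    by (simp add: sin_add sin_diff)
  from this[of "of_int j * (pi / real p)" "pi / real p"]
  have "sin (of_int (j + 1) * (pi / real p)) + sin (of_int (j - 1) * (pi / real p))
          = lam * sin (of_int j * (pi / real p))"
    by (simp add: hecke_lambda_def distrib_right left_diff_distrib add_divide_distrib diff_divide_distrib)
  then show ?thesis
    unfolding chord_def add_divide_distrib[symmetric] by simp
qed

lemma chord_reflect: "s (int p - j) = s j"
proof -
  have "of_int (int p - j) * (pi / real p) = pi - of_int j * (pi / real p)"
    using p3 by (simp add: field_simps)
  then show ?thesis by (simp add: chord_def)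
qed

lemma chord_neg1 [simp]: "s (- 1) = - 1" "s (int p + 1) = - 1" "s (int p - 1) = 1"
  using chord_rec[of 0] chord_rec[of "int p"] chord_reflect[of 1] by simp_all

text \<open>The sine is at least \<open>sin (\<pi>/p)\<close> on \<open>[\<pi>/p, \<pi> - \<pi>/p]\<close>; no diagonal is shorter than a side.\<close>

lemma chord_ge_1: "j \<in> letters \<Longrightarrow> s j \<ge> 1"
proof -
  have half: "s j \<ge> 1" if "1 \<le> j" "2 * j \<le> int p" for j
  proof -
    have "2 * real_of_int j \<le> real p" using that by linarith
    then have "pi * (2 * real_of_int j) \<le> pi * real p" by (intro mult_left_mono) auto
    then have 1: "of_int j * (pi / real p) \<le> pi / 2" using p3 by (simp add: field_simps)
    have "1 * (pi / real p) \<le> of_int j * (pi / real p)"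
      using that by (intro mult_right_mono) auto
    then have "sin (pi / real p) \<le> sin (of_int j * (pi / real p))"
      using 1 pi_p_bounds pi_gt_zero by (intro sin_monotone_2pi_le) linarith+
    then show ?thesis using sin_pi_p_pos by (simp add: chord_def)
  qed
  assume "j \<in> letters"
  then show ?thesis
    using half[of j] half[of "int p - j"] chord_reflect[of j] by (cases "2 * j \<le> int p") auto
qed

lemma lam_bounds: "1 \<le> lam" "lam < 2"
proof -
  show "1 \<le> lam" using chord_ge_1[of 2] chord_rec[of 1] p3 by simp
  have "cos (pi / real p) < cos 0"
    using p3 by (intro cos_monotone_0_pi) (auto simp: field_simps)
  then show "lam < 2" by (simp add: hecke_lambda_def)
qed

lemma gap_chord: "0 \<le> j \<Longrightarrow> j \<le> int p \<Longrightarrow> s j = 0 \<or> s j \<ge> 1"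
  using chord_ge_1[of j] by (cases "j = 0 \<or> j = int p") auto

lemma gap_V: "j \<in> letters \<Longrightarrow> gap_mat (V j)"
  unfolding gap_mat_def forall_2 Vmat_def mat2_nth by (intro conjI gap_chord) auto

lemma gap_word: "set js \<subseteq> letters \<Longrightarrow> gap_mat (word p js)"
proof (induction js)
  case Nil
  then show ?case by (auto simp: gap_mat_def mat_def)
qed (simp add: gap_mat_mult gap_V)

lemma V_0: "V 0 = - S2" and V_1: "V 1 = U2 lam" and V_p: "V (int p) = S2"
  using chord_rec[of 1] by (simp_all add: Vmat_def)

lemma T_V: "T ** V j = V (j + 1)"
  using chord_rec[of j] chord_rec[of "j + 1"] by (simp add: Vmat_def algebra_simps)

lemma T_in_G: "T \<in> G"
  by (intro hecke_mats_mult U2_in_hecke_mats S2_in_hecke_mats)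

lemma det_T [simp]: "det T = 1"
  by simp

lemma T_inv_V: "adj2 T ** V j = V (j - 1)"
  using T_V[of "j - 1"] adj2_cancel(4)[OF det_T, of "V (j - 1)"] by (simp del: mat2_mult)

lemma V_in_G: "V (int n) \<in> G"
proof (induction n)
  case 0
  then show ?case using hecke_mats_uminus[OF S2_in_hecke_mats] by (simp add: V_0)
next
  case (Suc n)
  then show ?case
    using hecke_mats_mult[OF T_in_G Suc] T_V[of "int n"] by (simp add: add.commute del: mat2_mult)
qed

lemma V_in_G': "j \<in> letters \<Longrightarrow> V j \<in> G"
  using V_in_G[of "nat j"] by simp

lemma word_in_G: "set js \<subseteq> letters \<Longrightarrow> word p js \<in> G"
  by (induction js) (simp_all add: hecke_mats_one hecke_mats_mult V_in_G')

text \<open>This is \<open>V\<^bsub>n + d\<^esub> = T\<^sup>n V\<^sub>d\<close> together with \<open>T\<^sup>n = V\<^sub>n S\<close>.\<close>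

lemma V_add: "V (int n + d) = V (int n) ** S2 ** V d"
proof (induction n)
  case 0
  have "- (S2 ** S2 ** V d) = V d" by (cases "V d" rule: mat2_cases) simp
  then show ?case by (simp add: V_0 del: mat2_mult uminus_mat2)
next
  case (Suc n)
  have "V (int (Suc n) + d) = T ** V (int n + d)" by (simp add: T_V algebra_simps del: mat2_mult)
  also have "\<dots> = (T ** V (int n)) ** S2 ** V d" by (simp only: Suc matrix_mul_assoc)
  finally show ?case by (simp add: T_V algebra_simps del: mat2_mult)
qed

lemma transpose_V: "transpose (V j) = V (int p - j)"
  using chord_reflect[of j] chord_reflect[of "j + 1"] chord_reflect[of "j - 1"]
  by (simp add: Vmat_def algebra_simps)

text \<open>
  The normal form of the free product of \<open>\<langle>S\<rangle>\<close> and \<open>\<langle>T\<rangle>\<close> (orders \<open>2\<close> and \<open>p\<close> modulo sign): an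
  alternating product of \<open>S\<close> and powers of \<open>T\<close>, with each power of \<open>T\<close> and the following \<open>S\<close>
  collected in one letter \<open>V\<^sub>j\<close>. Letters need no intervening \<open>S\<close>, which can survive only at the
  two ends.
\<close>

definition reduced :: "real^2^2 \<Rightarrow> bool" where
  "reduced A \<longleftrightarrow> (\<exists>js L R. set js \<subseteq> letters \<and> L \<in> {mat 1, S2} \<and> R \<in> {mat 1, S2} \<and>
     (A = L ** word p js ** R \<or> A = - (L ** word p js ** R)))"

lemma reducedI:
  assumes "set js \<subseteq> letters" "L \<in> {mat 1, S2}" "R \<in> {mat 1, S2}"
    and "A = L ** word p js ** R \<or> A = - (L ** word p js ** R)"
  shows "reduced A"
  using assms unfolding reduced_def by blast

lemma reduced_uminus: "reduced A \<Longrightarrow> reduced (- A)"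
  unfolding reduced_def by (metis minus_minus)

lemma S2_S2: "S2 ** (S2 ** X) = - (X :: real^2^2)"
  by (cases X rule: mat2_cases) simp

lemma reduced_S: "reduced A \<Longrightarrow> reduced (S2 ** A)"
proof -
  assume "reduced A"
  then obtain js L R where A: "set js \<subseteq> letters" "L \<in> {mat 1, S2}" "R \<in> {mat 1, S2}"
    "A = L ** word p js ** R \<or> A = - (L ** word p js ** R)"
    unfolding reduced_def by blast
  show ?thesis
  proof (cases "L = S2")
    case True
    show ?thesis
      by (rule reducedI[of js "mat 1" R])
         (use A True in \<open>auto simp: S2_S2 matrix_mul_assoc[symmetric] simp del: mat2_mult\<close>)
  next
    case False
    show ?thesis
      by (rule reducedI[of js S2 R])
         (use A False in \<open>auto simp: matrix_mul_assoc[symmetric] simp del: mat2_mult\<close>)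
  qed
qed

text \<open>Multiplication by \<open>T\<^sup>\<plusminus>\<^sup>1\<close> shifts the index of the first letter, and the letter turns into \<open>\<plusminus> S\<close>
when its index reaches \<open>0\<close> or \<open>p\<close>. A word with no letters or with a leading \<open>S\<close> acquires a letter
instead, because \<open>T S = - V\<^sub>1\<close> and \<open>T\<inverse> S = V\<^bsub>p - 1\<^esub>\<close>.\<close>

lemma reduced_T:
  assumes "reduced A"
  shows "reduced (T ** A)" "reduced (adj2 T ** A)"
proof -
  obtain js L R where A: "set js \<subseteq> letters" "L \<in> {mat 1, S2}" "R \<in> {mat 1, S2}"
    "A = L ** word p js ** R \<or> A = - (L ** word p js ** R)"
    using assms unfolding reduced_def by blast
  have TS: "T ** S2 = - V 1" "adj2 T ** S2 = V (int p - 1)" "T = V 1 ** S2"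
    using T_inv_V[of "int p"] by (simp_all add: V_1 V_p)
  have one: "1 \<in> letters" "int p - 1 \<in> letters" using p3 by auto
  have sgn: "reduced (X ** A)" if "reduced (X ** (L ** word p js ** R))" for X
    using A(4) that reduced_uminus[OF that] by (elim disjE) simp_all
  have "reduced (T ** (L ** word p js ** R)) \<and> reduced (adj2 T ** (L ** word p js ** R))"
  proof (cases "L = S2")
    case True
    have "T ** (L ** word p js ** R) = - (mat 1 ** word p (1 # js) ** R)"
      "adj2 T ** (L ** word p js ** R) = mat 1 ** word p ((int p - 1) # js) ** R"
      using True TS(1,2) by (simp_all only: matrix_mul_assoc word_simps matrix_mul_lid matrix_neg_left)
    moreover have "set (1 # js) \<subseteq> letters" "set ((int p - 1) # js) \<subseteq> letters"
      using A(1) one by auto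
    ultimately show ?thesis
      using A(3) reducedI[of "1 # js" "mat 1" R] reducedI[of "(int p - 1) # js" "mat 1" R] by blast
  next
    case False
    then have L: "L = mat 1" using A(2) by auto
    show ?thesis
    proof (cases js)
      case Nil
      have T': "reduced (T ** R)"
      proof (cases "R = S2")
        case True
        show ?thesis
          by (rule reducedI[of "[1]" "mat 1" "mat 1"]) (use True one TS in \<open>simp_all del: mat2_mult\<close>)
      next
        case False
        with A have "R = mat 1" by auto
        show ?thesis
          by (rule reducedI[of "[1]" "mat 1" S2]) (use \<open>R = mat 1\<close> one in \<open>simp_all add: V_1 del: mat2_mult\<close>)
      qed
      have T'': "reduced (adj2 T ** R)"
      proof (cases "R = S2")
        case True
        show ?thesis
          by (rule reducedI[of "[int p - 1]" "mat 1" "mat 1"])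
             (use True one TS in \<open>simp_all del: mat2_mult\<close>)
      next
        case False
        with A have "R = mat 1" by auto
        have "adj2 T = - (V (int p - 1) ** S2)"
          unfolding TS(2)[symmetric] by simp
        then show ?thesis
          by (intro reducedI[of "[int p - 1]" "mat 1" S2])
             (use \<open>R = mat 1\<close> one in \<open>simp_all del: mat2_mult adj2_mat2\<close>)
      qed
      from T' T'' show ?thesis by (simp add: Nil L del: mat2_mult)
    next
      case (Cons j js')
      have j: "j \<in> letters" and js': "set js' \<subseteq> letters" using A Cons by auto
      have 1: "T ** (L ** word p js ** R) = V (j + 1) ** word p js' ** R"
        "adj2 T ** (L ** word p js ** R) = V (j - 1) ** word p js' ** R"
        unfolding Cons L by (simp_all only: matrix_mul_assoc word_simps matrix_mul_lid T_V T_inv_V)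
      have 2: "reduced (V (j + 1) ** word p js' ** R)"
      proof (cases "j = int p - 1")
        case True
        then show ?thesis
          by (intro reducedI[of js' S2 R]) (use A js' in \<open>simp_all add: V_p\<close>)
      next
        case False
        then show ?thesis
          by (intro reducedI[of "(j + 1) # js'" "mat 1" R]) (use A j js' in simp_all)
      qed
      have 3: "reduced (V (j - 1) ** word p js' ** R)"
      proof (cases "j = 1")
        case True
        then show ?thesis
          by (intro reducedI[of js' S2 R]) (use A js' in \<open>simp_all add: V_0 del: uminus_mat2\<close>)
      next
        case False
        then show ?thesis
          by (intro reducedI[of "(j - 1) # js'" "mat 1" R]) (use A j js' in simp_all)
      qed
      from 1 2 3 show ?thesis by simp
    qed
  qed
  then show "reduced (T ** A)" "reduced (adj2 T ** A)"
    using sgn by blast+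
qed

text \<open>The reduced matrices are stable under left multiplication by \<open>S\<close> and \<open>T\<^sup>\<plusminus>\<^sup>1\<close>, and
\<open>U = - T S\<close>, \<open>U\<inverse> = S T\<inverse>\<close>.\<close>

lemma G_reduced:
  assumes "A \<in> G"
  shows "reduced A"
proof -
  have "\<forall>X. reduced X \<longrightarrow> reduced (A ** X)"
    using assms
  proof (induction rule: hecke_mats_induct)
    case U
    have "U2 lam ** X = - (T ** (S2 ** X))" for X :: "real^2^2"
      by (simp add: matrix_mul_assoc[symmetric] S2_S2 del: mat2_mult)
    then show ?case by (metis reduced_uminus reduced_T(1) reduced_S)
  next
    case U_inv
    have "U2 (- lam) ** X = S2 ** (adj2 T ** X)" for X :: "real^2^2"
      by (simp add: matrix_mul_assoc)
    then show ?case by (metis reduced_T(2) reduced_S)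
  next
    case (mult A B)
    then show ?case by (simp add: matrix_mul_assoc[symmetric])
  qed (auto simp: reduced_S reduced_uminus simp del: uminus_mat2)
  moreover have "reduced (mat 1)"
    by (rule reducedI[of "[]" "mat 1" "mat 1"]) auto
  ultimately have "reduced (A ** mat 1)" by blast
  then show ?thesis by simp
qed

text \<open>Factors \<open>S\<close> at the ends only permute the entries of a word and change signs.\<close>

theorem G_entry_gap:
  assumes "mat2 a b c d \<in> G"
  shows "a = 0 \<or> \<bar>a\<bar> \<ge> 1" "b = 0 \<or> \<bar>b\<bar> \<ge> 1" "c = 0 \<or> \<bar>c\<bar> \<ge> 1" "d = 0 \<or> \<bar>d\<bar> \<ge> 1"
proof -
  obtain js L R where A: "set js \<subseteq> letters" "L \<in> {mat 1, S2}" "R \<in> {mat 1, S2}"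
    "mat2 a b c d = L ** word p js ** R \<or> mat2 a b c d = - (L ** word p js ** R)"
    using G_reduced[OF assms] unfolding reduced_def by blast
  obtain x y z w where W: "word p js = mat2 x y z w" by (rule mat2_cases)
  have "gap_mat (mat2 x y z w)" using gap_word[OF A(1)] W by simp
  then have "x = 0 \<or> x \<ge> 1" "y = 0 \<or> y \<ge> 1" "z = 0 \<or> z \<ge> 1" "w = 0 \<or> w \<ge> 1"
    unfolding gap_mat_def forall_2 mat2_nth by auto
  then show "a = 0 \<or> \<bar>a\<bar> \<ge> 1" "b = 0 \<or> \<bar>b\<bar> \<ge> 1" "c = 0 \<or> \<bar>c\<bar> \<ge> 1" "d = 0 \<or> \<bar>d\<bar> \<ge> 1"
    using A(2-4) unfolding W by auto
qed

end

context hecke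
begin

section \<open>The pseudo-Euclidean algorithm\<close>

lemma lam_pos: "lam > 0"
  using lam_bounds by simp

lemma nearest_multiple:
  assumes "y \<noteq> 0"
  obtains n :: int where "\<bar>x - y * (of_int n * lam)\<bar> \<le> \<bar>y * lam\<bar> / 2"
proof -
  define n where "n = round (x / (y * lam))"
  have "\<bar>x / (y * lam) - of_int n\<bar> \<le> 1 / 2"
    using of_int_round_abs_le[of "x / (y * lam)"] by (simp add: n_def abs_minus_commute)
  then have "\<bar>y * lam\<bar> * \<bar>x / (y * lam) - of_int n\<bar> \<le> \<bar>y * lam\<bar> * (1 / 2)"
    by (intro mult_left_mono) auto
  moreover have "y * lam * (x / (y * lam) - of_int n) = x - y * (of_int n * lam)"
    using assms lam_pos by (simp add: right_diff_distrib)
  then have "\<bar>y * lam\<bar> * \<bar>x / (y * lam) - of_int n\<bar> = \<bar>x - y * (of_int n * lam)\<bar>"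
    by (metis abs_mult)
  ultimately show ?thesis using that[of n] by simp
qed

text \<open>Translating by the nearest multiple of \<open>\<lambda>\<close> leaves an upper right entry of absolute value at most
\<open>\<lambda>/2 < 1\<close>, which vanishes by the entry gap.\<close>

lemma upper_right_multiple:
  assumes "mat2 a x c 1 \<in> G"
  obtains n :: int where "x = of_int n * lam"
proof -
  obtain n :: int where n: "\<bar>x - 1 * (of_int n * lam)\<bar> \<le> \<bar>1 * lam\<bar> / 2"
    using nearest_multiple[of 1 x] by auto
  have "U2 (of_int (- n) * lam) ** mat2 a x c 1 \<in> G"
    by (intro hecke_mats_mult U2_int_in_hecke_mats assms)
  then have "mat2 (a - of_int n * lam * c) (x - of_int n * lam) c 1 \<in> G" by simp
  from G_entry_gap(2)[OF this] n lam_bounds have "x = of_int n * lam" by auto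
  then show ?thesis by (rule that)
qed

text \<open>The reason why two admissible columns suffice: let \<open>N\<close> and \<open>N'\<close> be matrices in \<open>G\<close> that have the
first and the second column, respectively, in common with \<open>M\<close>. The lower right entry of \<open>N\<inverse> N'\<close> is
\<open>det M = 1\<close>, so its upper right entry, which is the \<open>x\<close> with \<open>M = N U\<^sup>x\<close>, is a multiple of \<open>\<lambda>\<close>.\<close>

theorem G_if_columns:
  assumes "mat2 a b' c d' \<in> G" "mat2 a' b c' d \<in> G" and det: "a * d - b * c = 1"
  shows "mat2 a b c d \<in> G"
proof -
  have det': "a * d' - b' * c = 1" using hecke_mats_det[OF assms(1)] by simp
  have "adj2 (mat2 a b' c d') ** mat2 a' b c' d \<in> G"
    by (intro hecke_mats_mult hecke_mats_adj assms)
  moreover have "adj2 (mat2 a b' c d') ** mat2 a' b c' d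
      = mat2 (d' * a' - b' * c') (d' * b - b' * d) (a * c' - c * a') 1"
    using det by (simp add: algebra_simps)
  ultimately obtain n :: int where n: "d' * b - b' * d = of_int n * lam"
    by (metis upper_right_multiple)
  have "mat2 a b' c d' ** U2 (d' * b - b' * d) \<in> G"
    unfolding n by (intro hecke_mats_mult U2_int_in_hecke_mats assms)
  moreover have "a * (d' * b - b' * d) + b' = b" "c * (d' * b - b' * d) + d' = d"
    using det det' by algebra+
  ultimately show ?thesis by simp
qed

text \<open>The step from \<open>(x, y)\<close> to \<open>(y, x)\<close> is \<open>S\<close> up to a relative sign, which the reflection removes.\<close>

lemma column_swap:
  assumes "mat2 x u y v \<in> G"
  shows "mat2 y v x u \<in> G \<or> mat2 y (- v) x (- u) \<in> G"
proof -
  have "S2 ** mat2 x (- u) (- y) v \<in> G"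
    by (intro hecke_mats_mult S2_in_hecke_mats hecke_mats_reflect assms)
  then show ?thesis by simp
qed

text \<open>The remainders are again entries of matrices in \<open>G\<close>, and each is at most \<open>\<lambda>/2\<close> times the previous
one in absolute value, so they cannot stay above the entry gap. The last nonzero one
stands in a column next to \<open>0\<close> and has absolute value \<open>1\<close> because the determinant is \<open>1\<close>.\<close>

lemma G_column_pseudo_gcd:
  assumes "mat2 x u y v \<in> G" "y \<noteq> 0"
  shows "pseudo_gcd p x y 1"
proof -
  \<comment> \<open>By the entry gap the bound allows at most \<open>n\<close> steps.\<close>
  have *: "pseudo_gcd p x y 1"
    if "mat2 x u y v \<in> G" "y \<noteq> 0" "\<bar>y\<bar> * (lam / 2) ^ n < 1" for n x u y v
    using that
  proof (induction n arbitrary: x u y v)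
    case 0
    then show ?case using G_entry_gap(3)[OF 0(1)] by simp
  next
    case (Suc n)
    obtain m :: int where m: "\<bar>x - y * (of_int m * lam)\<bar> \<le> \<bar>y * lam\<bar> / 2"
      by (rule nearest_multiple[OF Suc.prems(2)])
    define r where "r = x - y * (of_int m * lam)"
    have x: "x = y * (of_int m * lam) + r" by (simp add: r_def)
    have "U2 (of_int (- m) * lam) ** mat2 x u y v \<in> G"
      by (intro hecke_mats_mult U2_int_in_hecke_mats Suc)
    then have M: "mat2 r (u - of_int m * lam * v) y v \<in> G"
      by (simp add: r_def algebra_simps)
    show ?case
    proof (cases "r = 0")
      case True
      have "(u - of_int m * lam * v) * y = - 1" using hecke_mats_det[OF M] True by simp
      then have "\<bar>u - of_int m * lam * v\<bar> * \<bar>y\<bar> = 1" unfolding abs_mult[symmetric] by simp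
      moreover have "\<bar>u - of_int m * lam * v\<bar> \<ge> 1" "\<bar>y\<bar> \<ge> 1"
        using G_entry_gap(2,3)[OF M] \<open>y \<noteq> 0\<close> calculation by auto
      ultimately have "\<bar>y\<bar> = 1"
        using mult_right_mono[of 1 "\<bar>u - of_int m * lam * v\<bar>" "\<bar>y\<bar>"] by linarith
      then show ?thesis using pseudo_gcd.stop[of y x m p] \<open>y \<noteq> 0\<close> True x by simp
    next
      case False
      have "mat2 y v r (u - of_int m * lam * v) \<in> G \<or> mat2 y (- v) r (- (u - of_int m * lam * v)) \<in> G"
        by (rule column_swap[OF M])
      moreover have "\<bar>r\<bar> * (lam / 2) ^ n < 1"
      proof -
        have "\<bar>r\<bar> * (lam / 2) ^ n \<le> \<bar>y * lam\<bar> / 2 * (lam / 2) ^ n"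
          using m lam_pos by (intro mult_right_mono) (auto simp: r_def)
        also have "\<dots> = \<bar>y\<bar> * (lam / 2) ^ Suc n" using lam_pos by (simp add: abs_mult)
        finally show ?thesis using Suc.prems(3) by linarith
      qed
      ultimately have "pseudo_gcd p y r 1" using Suc.IH False by blast
      then show ?thesis
        using m unfolding r_def[symmetric] abs_le_iff
        by (intro pseudo_gcd.step[OF Suc.prems(2) x False]) linarith+
    qed
  qed
  have "\<exists>n. (lam / 2) ^ n < 1 / \<bar>y\<bar>"
    using lam_bounds assms(2) by (intro real_arch_pow_inv) auto
  then obtain n where "\<bar>y\<bar> * (lam / 2) ^ n < 1" using assms(2) by (auto simp: field_simps)
  with * assms show ?thesis by blast
qed

text \<open>Running the algorithm backwards multiplies \<open>(\<plusminus> 1, 0)\<close> by translations and swaps.\<close>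

lemma pseudo_gcd_column:
  "pseudo_gcd p x y d \<Longrightarrow> d > 0 \<and> (\<exists>u v. mat2 (x / d) u (y / d) v \<in> G)"
proof (induction rule: pseudo_gcd.induct)
  case (stop y x n)
  have "U2 (of_int n * lam) ** S2 \<in> G"
    by (intro hecke_mats_mult U2_int_in_hecke_mats S2_in_hecke_mats)
  then have M: "mat2 (of_int n * lam) (- 1) 1 0 \<in> G" by simp
  show ?case
  proof (cases "y > 0")
    case True
    then show ?thesis using M stop by auto
  next
    case False
    have "mat2 (- (of_int n * lam)) 1 (- 1) 0 \<in> G" using hecke_mats_uminus[OF M] by simp
    then show ?thesis using False stop by auto
  qed
next
  case (step y x n r d)
  then obtain u v where "mat2 (y / d) u (r / d) v \<in> G" and d: "d > 0" by blast
  then obtain u' v' where "mat2 (r / d) u' (y / d) v' \<in> G" using column_swap by blast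
  then have "U2 (of_int n * lam) ** mat2 (r / d) u' (y / d) v' \<in> G"
    by (intro hecke_mats_mult U2_int_in_hecke_mats)
  moreover have "r / d + of_int n * lam * (y / d) = x / d"
    using step.hyps(2) d by (simp add: field_simps)
  ultimately show ?case using d by auto
qed

text \<open>The two columns of a symmetric matrix are \<open>(A, a)\<close> and \<open>(a, D)\<close>, and the second one is admissible
together with \<open>(D, a)\<close>.\<close>

theorem symmetric_in_G_iff:
  assumes "A * D - a\<^sup>2 = 1" "a \<noteq> 0"
  shows "mat2 A a a D \<in> G \<longleftrightarrow> pseudo_gcd p A a 1 \<and> pseudo_gcd p D a 1"
proof
  assume M: "mat2 A a a D \<in> G"
  have "mat2 D (- a) (- a) A \<in> G" using hecke_mats_adj[OF M] by simp
  from hecke_mats_reflect[OF this] have "mat2 D a a A \<in> G" by simp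
  with M show "pseudo_gcd p A a 1 \<and> pseudo_gcd p D a 1"
    using G_column_pseudo_gcd[OF _ assms(2)] by simp
next
  assume "pseudo_gcd p A a 1 \<and> pseudo_gcd p D a 1"
  then obtain u v w z where 1: "mat2 A u a v \<in> G" and "mat2 D w a z \<in> G"
    using pseudo_gcd_column[of A a 1] pseudo_gcd_column[of D a 1] by auto
  then obtain w' z' where "mat2 a w' D z' \<in> G" using column_swap by blast
  then have "mat2 a w' D z' ** S2 \<in> G" by (intro hecke_mats_mult S2_in_hecke_mats)
  then have "mat2 w' (- a) z' (- D) \<in> G" by simp
  from hecke_mats_uminus[OF this] have 2: "mat2 (- w') a (- z') D \<in> G" by simp
  show "mat2 A a a D \<in> G"
    by (rule G_if_columns[OF 1 2]) (use assms in \<open>simp add: power2_eq_square\<close>)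
qed

section \<open>Conjugacy of involutions\<close>

lemma word_nonneg: "set js \<subseteq> letters \<Longrightarrow> word p js $ i $ k \<ge> 0"
  using gap_word[of js] unfolding gap_mat_def by (metis order.refl order.trans zero_le_one)

lemma word_det: "set js \<subseteq> letters \<Longrightarrow> det (word p js) = 1"
  using word_in_G hecke_mats_det by blast

text \<open>If the first letters are \<open>V\<^sub>j\<close> and \<open>V\<^bsub>j + d\<^esub> = V\<^sub>j S V\<^sub>d\<close> with \<open>d > 0\<close>, then cancelling \<open>V\<^sub>j\<close> yields
\<open>W = S W'\<close> with nonnegative words \<open>W\<close> and \<open>W'\<close>. But \<open>S\<close> negates the lower row of \<open>W'\<close>, which must
then vanish.\<close>

lemma first_letter_unique:
  assumes "set (j # js) \<subseteq> letters" "set (k # ks) \<subseteq> letters"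
    and "word p (j # js) = word p (k # ks)"
  shows "j = k"
proof -
  have less: False
    if h: "set (j # js) \<subseteq> letters" "set (k # ks) \<subseteq> letters"
      "word p (j # js) = word p (k # ks)" "j < k" for j k js ks
  proof -
    define d where "d = k - j"
    have d: "set (d # ks) \<subseteq> letters" using h by (auto simp: d_def)
    have Vk: "V k = V j ** S2 ** V d" using V_add[of "nat j" d] h by (simp add: d_def)
    have detV: "det (V j) = 1" using h by (intro hecke_mats_det[OF V_in_G']) auto
    have "word p js = adj2 (V j) ** word p (j # js)"
      by (simp add: adj2_cancel[OF detV])
    also have "\<dots> = adj2 (V j) ** (V j ** (S2 ** (V d ** word p ks)))"
      by (simp only: h(3) word_simps(2)[of p k ks] Vk matrix_mul_assoc)
    also have "\<dots> = S2 ** word p (d # ks)"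
      by (simp only: adj2_cancel[OF detV] word_simps)
    finally have eq: "word p js = S2 ** word p (d # ks)" .
    obtain x y z w where W: "word p (d # ks) = mat2 x y z w" by (rule mat2_cases)
    have "z \<ge> 0" "w \<ge> 0" "- z \<ge> 0" "- w \<ge> 0"
      using word_nonneg[OF d, of 2 1] word_nonneg[OF d, of 2 2] word_nonneg[of js 1 1]
        word_nonneg[of js 1 2] h(1) unfolding eq W by auto
    then show False using word_det[OF d] unfolding W by simp
  qed
  show ?thesis
    using less[OF assms] less[OF assms(2,1) assms(3)[symmetric]] by (meson linorder_cases)
qed

lemma transpose_word:
  "transpose (word p js) = word p (rev (map (\<lambda>j. int p - j) js))"
  by (induction js) (simp_all add: word_append matrix_transpose_mul transpose_V)

text \<open>By uniqueness of the first letter, a symmetric word that begins with \<open>V\<^sub>j\<close> ends with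
\<open>V\<^bsub>p - j\<^esub> = V\<^sub>j\<^sup>T\<close>, and what lies between is symmetric again. Peeling off such pairs leaves
no letter at all, because a single symmetric letter would need \<open>2 j = p\<close>.\<close>

lemma symmetric_word:
  assumes "odd p" "set js \<subseteq> letters" "transpose (word p js) = word p js"
  shows "\<exists>W\<in>G. word p js = W ** transpose W"
  using assms(2,3)
proof (induction "length js" arbitrary: js rule: less_induct)
  case less
  show ?case
  proof (cases js)
    case Nil
    then show ?thesis by (intro bexI[of _ "mat 1"]) (auto simp: hecke_mats_one)
  next
    case (Cons j js')
    obtain ks k where k: "js = ks @ [k]" using Cons by (metis rev_exhaust list.distinct(1))
    have "word p (j # js') = word p ((int p - k) # rev (map (\<lambda>j. int p - j) ks))"
    proof -
      have "word p js = word p (rev (map (\<lambda>j. int p - j) (ks @ [k])))"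
        using less.prems(2) transpose_word[of js] unfolding k by simp
      then show ?thesis unfolding Cons by simp
    qed
    moreover have "set (ks @ [k]) \<subseteq> letters" "set (j # js') \<subseteq> letters"
      using less.prems(1) unfolding k[symmetric] Cons[symmetric] by blast+
    ultimately have jk: "j = int p - k"
      by (intro first_letter_unique[of j js']) auto
    show ?thesis
    proof (cases ks)
      case Nil
      then have "2 * k = int p" using jk Cons k by simp
      with assms(1) show ?thesis by presburger
    next
      case (Cons j' ks')
      have js: "js = j # ks' @ [k]" using Cons k \<open>js = j # js'\<close> by simp
      have Vk: "V k = transpose (V j)" by (simp add: transpose_V jk)
      have j: "j \<in> letters" "set ks' \<subseteq> letters" using less.prems(1) js by auto
      have detj: "det (V j) = 1" "det (transpose (V j)) = 1"
        using hecke_mats_det[OF V_in_G'[OF j(1)]] by simp_all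
      have W: "word p js = V j ** word p ks' ** transpose (V j)"
        by (simp add: js word_append Vk matrix_mul_assoc)
      have "word p ks' = adj2 (V j) ** word p js ** adj2 (transpose (V j))"
        unfolding W by (simp add: matrix_mul_assoc adj2_left_inverse[OF detj(1)] adj2_cancel[OF detj(2)])
      moreover have "transpose (adj2 (V j) ** word p js ** adj2 (transpose (V j)))
          = adj2 (V j) ** word p js ** adj2 (transpose (V j))"
      proof -
        have adj: "transpose (adj2 X) = adj2 (transpose X)" for X
          by (cases X rule: mat2_cases) simp
        show ?thesis by (simp add: matrix_transpose_mul adj less.prems(2) matrix_mul_assoc)
      qed
      ultimately have "transpose (word p ks') = word p ks'" by simp
      with less.hyps[of ks'] j js obtain X where X: "X \<in> G" "word p ks' = X ** transpose X"
        by auto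
      show ?thesis
        by (intro bexI[of _ "V j ** X"])
           (simp_all add: W X matrix_transpose_mul matrix_mul_assoc hecke_mats_mult V_in_G' j(1)[simplified])
    qed
  qed
qed

text \<open>A nonnegative matrix with zero diagonal has determinant at most \<open>0\<close>.\<close>

lemma word_trace_nonzero: "set js \<subseteq> letters \<Longrightarrow> trace (word p js) \<noteq> 0"
proof
  assume js: "set js \<subseteq> letters" and tr: "trace (word p js) = 0"
  obtain x y z w where W: "word p js = mat2 x y z w" by (rule mat2_cases)
  have "x \<ge> 0" "y \<ge> 0" "z \<ge> 0" "w \<ge> 0"
    using word_nonneg[OF js] unfolding W by (metis mat2_nth)+
  moreover from this tr have "x = 0" "w = 0" unfolding W by simp_all
  moreover have "x * w = 0" using calculation by simp
  moreover have "x * w - y * z = 1" using word_det[OF js] unfolding W by simp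
  moreover have "y * z \<ge> 0" using calculation(2,3) by simp
  ultimately show False by linarith
qed

text \<open>This follows from \<open>W\<^sup>T = S W\<^sup>-\<^sup>1 S\<^sup>-\<^sup>1\<close> for \<open>det W = 1\<close>; with the adjugate it is an identity for all \<open>W\<close>.\<close>

lemma S_symmetric_conj:
  "S2 ** (W ** transpose W) = (S2 ** W) ** S2 ** adj2 (S2 ** W)"
  by (cases W rule: mat2_cases) (simp add: algebra_simps)

text \<open>In reduced form an element of trace \<open>0\<close> has exactly one \<open>S\<close> at its ends, since otherwise its trace is
plus or minus that of a word. The trace of \<open>S W\<close> or \<open>W S\<close> is the difference of the
off-diagonal entries of \<open>W\<close> up to sign, so the word is symmetric.\<close>

theorem involution_conj_S:
  assumes "odd p" "A \<in> G" "trace A = 0"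
  shows "\<exists>X\<in>G. A = X ** S2 ** adj2 X \<or> A = - (X ** S2 ** adj2 X)"
proof -
  obtain js L R where js: "set js \<subseteq> letters" and LR: "L \<in> {mat 1, S2}" "R \<in> {mat 1, S2}"
    and A: "A = L ** word p js ** R \<or> A = - (L ** word p js ** R)"
    using G_reduced[OF assms(2)] unfolding reduced_def by blast
  obtain x y z w where W: "word p js = mat2 x y z w" by (rule mat2_cases)
  have "x + w \<noteq> 0" using word_trace_nonzero[OF js] unfolding W by simp
  then have LR': "L = S2 \<and> R = mat 1 \<or> L = mat 1 \<and> R = S2" and "y = z"
    using A LR assms(3) unfolding W mat_1_mat2 by auto
  then obtain K where K: "K \<in> G" "word p js = K ** transpose K"
    using symmetric_word[OF assms(1) js] W by auto
  define X where "X = S2 ** K"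
  have X: "X \<in> G" unfolding X_def by (intro hecke_mats_mult S2_in_hecke_mats K)
  have SW: "S2 ** word p js = X ** S2 ** adj2 X"
    unfolding K X_def by (rule S_symmetric_conj)
  have "word p js ** S2 = adj2 S2 ** (S2 ** word p js) ** S2"
    by (cases "word p js" rule: mat2_cases) simp
  also have "\<dots> = (adj2 S2 ** X) ** S2 ** adj2 (adj2 S2 ** X)"
    unfolding SW adj2_mult adj2_adj2 by (simp only: matrix_mul_assoc)
  finally have WS: "word p js ** S2 = (adj2 S2 ** X) ** S2 ** adj2 (adj2 S2 ** X)" .
  have X': "adj2 S2 ** X \<in> G" by (intro hecke_mats_mult hecke_mats_adj S2_in_hecke_mats X)
  from LR' show ?thesis
  proof
    assume "L = S2 \<and> R = mat 1"
    with A SW have "A = X ** S2 ** adj2 X \<or> A = - (X ** S2 ** adj2 X)" by simp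
    with X show ?thesis by blast
  next
    assume "L = mat 1 \<and> R = S2"
    with A WS have "A = (adj2 S2 ** X) ** S2 ** adj2 (adj2 S2 ** X)
        \<or> A = - ((adj2 S2 ** X) ** S2 ** adj2 (adj2 S2 ** X))" by (simp only: matrix_mul_lid)
    with X' show ?thesis by blast
  qed
qed

end

text \<open>The matrix \<open>h\<close> anticommutes with \<open>g - g\<inverse>\<close>. Comparing entries, each entry of \<open>g - g\<inverse>\<close>
times the trace of \<open>h\<close> is \<open>0\<close>, and \<open>g = g\<inverse>\<close> only for \<open>g = \<plusminus> 1\<close>.\<close>

lemma conjugator_trace_zero:
  assumes "det g = 1" "h ** g = adj2 g ** h" "g \<noteq> mat 1" "g \<noteq> - mat 1"
  shows "trace h = 0"
proof (rule ccontr)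
  assume "trace h \<noteq> 0"
  obtain a b c d where g: "g = mat2 a b c d" by (rule mat2_cases)
  obtain e f k l where h: "h = mat2 e f k l" by (rule mat2_cases)
  have tr: "e + l \<noteq> 0" using \<open>trace h \<noteq> 0\<close> h by simp
  have eqs: "e * a + f * c = d * e - b * k" "e * b + f * d = d * f - b * l"
    "k * a + l * c = a * k - c * e" "k * b + l * d = a * l - c * f"
    using assms(2) unfolding g h by (simp_all add: algebra_simps)
  have "b * (e + l) = 0" "c * (e + l) = 0" "(a - d) * (e + l) = 0"
    using eqs by algebra+
  then have bcd: "b = 0" "c = 0" "a = d" using tr by auto
  then have "a * a = 1" using assms(1) g by simp
  then have "a = 1 \<or> a = - 1" by (simp add: square_eq_1_iff)
  then show False using assms(3,4) bcd unfolding g mat_1_mat2 by auto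
qed

section \<open>Discrete subgroups of the real line\<close>

text \<open>Such an \<open>L\<close> is infinite cyclic, generated by its least positive element \<open>q\<close>. What matters below is
that \<open>L\<close> has exactly two cosets modulo \<open>2 L\<close>, represented by \<open>0\<close> and \<open>q\<close>.\<close>

lemma discrete_subgroup_index_2:
  fixes L :: "real set"
  assumes diff: "\<And>x y. x \<in> L \<Longrightarrow> y \<in> L \<Longrightarrow> x - y \<in> L"
    and e: "e > 0" "\<And>x. x \<in> L \<Longrightarrow> x > 0 \<Longrightarrow> x \<ge> e"
    and nontrivial: "z \<in> L" "z \<noteq> 0"
  obtains q where "q \<in> L" "\<And>x. x \<in> L \<Longrightarrow> \<exists>y\<in>L. x = 2 * y \<or> x = 2 * y + q"
    "\<And>y. y \<in> L \<Longrightarrow> 2 * y \<noteq> q"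
proof -
  have zero: "0 \<in> L" using diff[OF nontrivial(1) nontrivial(1)] by simp
  have neg: "- x \<in> L" if "x \<in> L" for x using diff[OF zero that] by simp
  define P where "P = {x \<in> L. x > 0}"
  have "z \<in> P \<or> - z \<in> P" using nontrivial neg by (auto simp: P_def)
  then have ne: "P \<noteq> {}" by blast
  have bdd: "bdd_below P" by (intro bdd_belowI[of _ 0]) (auto simp: P_def)
  \<comment> \<open>Two elements of \<open>P\<close> differ by at least \<open>e\<close>, so one this close to the infimum is minimal.\<close>
  have "Inf P < Inf P + e" using e by simp
  then obtain q where q: "q \<in> P" "q < Inf P + e" using cInf_lessD[OF ne] by blast
  have qL: "q \<in> L" "q > 0" using q by (auto simp: P_def)
  have min: "q \<le> x" if "x \<in> L" "x > 0" for x
  proof (rule ccontr)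
    assume "\<not> q \<le> x"
    then have "q - x \<ge> e" using e(2)[OF diff[OF qL(1) that(1)]] by simp
    moreover have "Inf P \<le> x" using that by (intro cInf_lower bdd) (auto simp: P_def)
    ultimately show False using q(2) by simp
  qed
  have nat: "real n * q \<in> L" for n
  proof (induction n)
    case (Suc n)
    then show ?case using diff[OF Suc neg[OF qL(1)]] by (simp add: algebra_simps)
  qed (simp add: zero)
  have int: "of_int n * q \<in> L" for n
    using nat[of "nat n"] neg[OF nat[of "nat (- n)"]] by (cases "n \<ge> 0") auto
  have mult: "\<exists>n :: int. x = of_int n * q" if "x \<in> L" for x
  proof
    have "x - of_int \<lfloor>x / q\<rfloor> * q \<in> L" by (intro diff that int)
    moreover have "of_int \<lfloor>x / q\<rfloor> * q \<le> x" "x < (of_int \<lfloor>x / q\<rfloor> + 1) * q"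
      using qL(2) by (simp_all add: pos_le_divide_eq[symmetric] pos_divide_less_eq[symmetric])
    ultimately show "x = of_int \<lfloor>x / q\<rfloor> * q"
      using min[of "x - of_int \<lfloor>x / q\<rfloor> * q"] unfolding distrib_right by linarith
  qed
  show ?thesis
  proof (rule that[OF qL(1)])
    fix x assume "x \<in> L"
    then obtain n :: int where n: "x = of_int n * q" using mult by blast
    have "n = 2 * (n div 2) \<or> n = 2 * (n div 2) + 1" by presburger
    then have "x = 2 * (of_int (n div 2) * q) \<or> x = 2 * (of_int (n div 2) * q) + q"
    proof
      assume "n = 2 * (n div 2)"
      then have "real_of_int n = 2 * of_int (n div 2)" by linarith
      then show ?thesis unfolding n by simp
    next
      assume "n = 2 * (n div 2) + 1"
      then have "real_of_int n = 2 * of_int (n div 2) + 1" by linarith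
      then show ?thesis unfolding n by (simp add: algebra_simps)
    qed
    then show "\<exists>y\<in>L. x = 2 * y \<or> x = 2 * y + q" using int by blast
  next
    fix y assume "y \<in> L"
    then show "2 * y \<noteq> q" using min[of y] qL(2) by auto
  qed
qed

section \<open>Symmetric matrices\<close>

lemma symmetric_iff_S: "S2 ** mat2 a b c d = adj2 (mat2 a b c d) ** S2 \<longleftrightarrow> b = c"
  by auto

lemma trace_zero_square:
  assumes "det A = 1" "trace (A :: real^2^2) = 0"
  shows "A ** A = - mat 1"
proof (cases A rule: mat2_cases)
  case (1 a b c d)
  then have "d = - a" "a * d - b * c = 1" using assms by simp_all
  then show ?thesis using 1 by (simp add: mat_1_mat2 algebra_simps)
qed

context hecke
begin

text \<open>A symmetric matrix and its inverse, which \<open>S\<close> conjugates to each other, have opposite off-diagonal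
entries; opposite matrices have opposite traces. The two positivity conditions pick one of these four.\<close>

definition sym_mats :: "(real^2^2) set" where
  "sym_mats = {mat2 A a a D | A a D. mat2 A a a D \<in> G \<and> a > 0 \<and> A + D > 0}"

lemma sym_matsD:
  assumes "M \<in> sym_mats"
  obtains A a D where "M = mat2 A a a D" "M \<in> G" "a > 0" "A + D > 0"
  using assms unfolding sym_mats_def by blast

lemma sym_mats_in_G: "M \<in> sym_mats \<Longrightarrow> M \<in> G"
  by (auto simp: sym_mats_def)

lemma diagonal_in_G:
  assumes "mat2 a 0 0 d \<in> G"
  shows "a = d \<and> (a = 1 \<or> a = - 1)"
proof -
  have det: "a * d = 1" using hecke_mats_det[OF assms] by simp
  then have "\<bar>a\<bar> * \<bar>d\<bar> = 1" unfolding abs_mult[symmetric] by simp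
  moreover have "\<bar>a\<bar> \<ge> 1" "\<bar>d\<bar> \<ge> 1" using G_entry_gap[OF assms] det by auto
  ultimately have "\<bar>a\<bar> = 1" using mult_left_mono[of 1 "\<bar>d\<bar>" "\<bar>a\<bar>"] by linarith
  then have "a = 1 \<or> a = - 1" by linarith
  then show ?thesis using det by auto
qed

lemma normalize_symmetric:
  assumes "mat2 A a a D \<in> G" "a \<noteq> 0" "A + D > 0"
  shows "\<exists>Y\<in>{mat 1, S2}. Y ** mat2 A a a D ** adj2 Y \<in> sym_mats"
proof (cases "a > 0")
  case True
  then show ?thesis using assms by (auto simp: sym_mats_def)
next
  case False
  have "S2 ** mat2 A a a D ** adj2 S2 \<in> G"
    by (intro hecke_mats_mult hecke_mats_adj S2_in_hecke_mats assms)
  then have "S2 ** mat2 A a a D ** adj2 S2 \<in> sym_mats"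
    using False assms by (auto simp: sym_mats_def)
  then show ?thesis by blast
qed

text \<open>In \<open>SL(2,\<real>)\<close> the element \<open>h g h\<inverse>\<close> is \<open>g\<inverse>\<close> or \<open>- g\<inverse>\<close>. The second case would give \<open>g\<close> the trace \<open>0\<close>
and make it an involution. In the first case \<open>h\<close> is conjugate to \<open>\<plusminus> S\<close>, and \<open>S\<close> inverts only
symmetric matrices.\<close>

theorem reciprocal_conj_symmetric:
  assumes "odd p" "g \<in> G" "h \<in> G"
    and inv: "psl (h ** g ** adj2 h) = psl (adj2 g)" and not_inv: "psl (g ** g) \<noteq> psl (mat 1)"
  shows "\<exists>X\<in>G. \<exists>M\<in>sym_mats. M = X ** g ** adj2 X \<or> M = - (X ** g ** adj2 X)"
proof -
  have det: "det g = 1" "det h = 1" using assms hecke_mats_det by auto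
  have ne: "g \<noteq> mat 1" "g \<noteq> - mat 1" using not_inv by auto
  have tr: "trace g \<noteq> 0" using trace_zero_square[OF det(1)] not_inv by (auto simp: psl_eq_iff)
  have tr_adj: "trace (adj2 g) = trace g" by (cases g rule: mat2_cases) simp
  have tr_neg: "trace (- X) = - trace X" for X :: "real^2^2" by (cases X rule: mat2_cases) simp
  have eq: "h ** g ** adj2 h = adj2 g"
  proof (rule ccontr)
    assume "h ** g ** adj2 h \<noteq> adj2 g"
    then have "h ** g ** adj2 h = - adj2 g" using inv by (auto simp: psl_eq_iff)
    then have "trace g = - trace g" using trace_conj[OF det(2), of g] by (simp add: tr_adj tr_neg)
    with tr show False by simp
  qed
  then have "h ** g = adj2 g ** h" using adj2_cancel(2)[OF det(2), of "h ** g"] by simp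
  then have "trace h = 0" by (rule conjugator_trace_zero[OF det(1) _ ne])
  then obtain K where K: "K \<in> G" "h = K ** S2 ** adj2 K \<or> h = - (K ** S2 ** adj2 K)"
    using involution_conj_S[OF assms(1,3)] by blast
  have detK: "det K = 1" by (rule hecke_mats_det[OF K(1)])
  define N where "N = adj2 K ** g ** K"
  have N: "N \<in> G" unfolding N_def by (intro hecke_mats_mult hecke_mats_adj K assms)
  have "(K ** S2 ** adj2 K) ** g ** adj2 (K ** S2 ** adj2 K) = adj2 g"
    using K(2) eq by auto
  then have e1: "adj2 K ** ((K ** S2 ** adj2 K) ** g ** adj2 (K ** S2 ** adj2 K)) ** K = adj2 K ** adj2 g ** K"
    by simp
  have e2: "adj2 K ** ((K ** S2 ** adj2 K) ** g ** adj2 (K ** S2 ** adj2 K)) ** K = S2 ** N ** adj2 S2"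
    unfolding N_def adj2_mult adj2_adj2
    by (simp only: matrix_mul_assoc[symmetric] adj2_cancel[OF detK] adj2_left_inverse[OF detK] matrix_mul_rid)
  have e3: "adj2 N = adj2 K ** adj2 g ** K"
    by (simp add: N_def adj2_mult matrix_mul_assoc)
  have sym: "S2 ** N ** adj2 S2 = adj2 N"
    by (rule trans[OF e2[symmetric] trans[OF e1 e3[symmetric]]])
  obtain A b c D where bc: "N = mat2 A b c D" by (rule mat2_cases)
  have "c = b" using arg_cong[OF sym, of "\<lambda>X. X $ 2 $ 1"] unfolding bc by simp
  have N': "mat2 A b b D \<in> G" using N unfolding bc \<open>c = b\<close> .
  have gN: "g = K ** N ** adj2 K"
    unfolding N_def by (simp only: matrix_mul_assoc[symmetric] adj2_cancel[OF detK])
      (simp only: adj2_right_inverse[OF detK] matrix_mul_rid)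
  have "b \<noteq> 0"
  proof
    assume "b = 0"
    then have "N = mat 1 \<or> N = - mat 1"
      using diagonal_in_G[of A D] N bc \<open>c = b\<close> by (auto simp: mat_1_mat2)
    then show False using ne gN by (auto simp: adj2_right_inverse[OF detK])
  qed
  have "trace N = trace g" using trace_conj[OF detK, of N] gN by simp
  then have trN: "A + D \<noteq> 0" using tr bc by simp
  obtain Y where Y: "Y \<in> G" "Y ** N ** adj2 Y \<in> sym_mats \<or> - (Y ** N ** adj2 Y) \<in> sym_mats"
  proof (cases "A + D > 0")
    case True
    obtain Y where Y: "Y \<in> {mat 1, S2}" "Y ** mat2 A b b D ** adj2 Y \<in> sym_mats"
      using normalize_symmetric[OF N' \<open>b \<noteq> 0\<close> True] ..
    have "Y \<in> G" using Y(1) hecke_mats_one S2_in_hecke_mats by (elim insertE emptyE) simp_all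
    with Y(2) show ?thesis using that[of Y] unfolding bc \<open>c = b\<close> by simp
  next
    case False
    have "mat2 (- A) (- b) (- b) (- D) \<in> G"
      using hecke_mats_uminus[OF N'] by simp
    with False trN \<open>b \<noteq> 0\<close>
    have "\<exists>Y\<in>{mat 1, S2}. Y ** mat2 (- A) (- b) (- b) (- D) ** adj2 Y \<in> sym_mats"
      by (intro normalize_symmetric) simp_all
    then obtain Y where Y: "Y \<in> {mat 1, S2}" "Y ** (- mat2 A b b D) ** adj2 Y \<in> sym_mats"
      unfolding uminus_mat2 ..
    have "Y \<in> G" using Y(1) hecke_mats_one S2_in_hecke_mats by (elim insertE emptyE) simp_all
    moreover have "- (Y ** N ** adj2 Y) \<in> sym_mats"
      using Y(2) unfolding bc \<open>c = b\<close> by (simp only: matrix_neg_left matrix_neg_right)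
    ultimately show ?thesis using that[of Y] by simp
  qed
  have "(Y ** adj2 K) ** g ** adj2 (Y ** adj2 K) = Y ** N ** adj2 Y"
    by (simp add: N_def adj2_mult matrix_mul_assoc)
  moreover have "Y ** adj2 K \<in> G" by (intro hecke_mats_mult hecke_mats_adj Y K)
  ultimately have "\<exists>X\<in>G. X ** g ** adj2 X \<in> sym_mats \<or> - (X ** g ** adj2 X) \<in> sym_mats"
    using Y(2) by (intro bexI[of _ "Y ** adj2 K"]) simp_all
  then show ?thesis by blast
qed

text \<open>Commuting with \<open>S\<close> means being a rotation, and by the entry gap a rotation in \<open>G\<close> is by a multiple of
a right angle. Anticommuting with \<open>S\<close> forces a negative determinant.\<close>

lemma commutes_with_S:
  assumes "k \<in> G" "S2 ** k = k ** S2 \<or> S2 ** k = - (k ** S2)"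
  shows "k \<in> {mat 1, - mat 1, S2, - S2}"
proof -
  obtain x y z w where k: "k = mat2 x y z w" by (rule mat2_cases)
  have det: "x * w - y * z = 1" using hecke_mats_det[OF assms(1)] k by simp
  have "z = - y \<and> w = x"
  proof (rule ccontr)
    assume "\<not> (z = - y \<and> w = x)"
    then have "z = y" "w = - x" using assms(2) unfolding k by auto
    then have "- (x * x) - y * y = 1" using det by simp
    then show False using zero_le_square[of x] zero_le_square[of y] by linarith
  qed
  then have k': "k = mat2 x y (- y) x" and sq: "x * x + y * y = 1" using k det by auto
  have gap: "x = 0 \<or> \<bar>x\<bar> \<ge> 1" "y = 0 \<or> \<bar>y\<bar> \<ge> 1"
    using G_entry_gap(1,2) assms(1) k' by blast+
  have big: "u * u \<ge> 1" if "\<bar>u\<bar> \<ge> 1" for u :: real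
    using that mult_mono[of 1 "\<bar>u\<bar>" 1 "\<bar>u\<bar>"] by simp
  have "x = 0 \<or> y = 0" using gap big[of x] big[of y] sq by linarith
  then show ?thesis
  proof
    assume "x = 0"
    then have "y = 1 \<or> y = - 1" using sq by (simp add: square_eq_1_iff)
    then show ?thesis using \<open>x = 0\<close> k' by (auto simp: mat_1_mat2)
  next
    assume "y = 0"
    then have "x = 1 \<or> x = - 1" using sq by (simp add: square_eq_1_iff)
    then show ?thesis using \<open>y = 0\<close> k' by (auto simp: mat_1_mat2)
  qed
qed

text \<open>Conjugation by \<open>S\<close> changes the sign of the off-diagonal entry.\<close>

lemma sym_mats_conj_rigid:
  assumes "N \<in> sym_mats" "k \<in> G" "S2 ** k = k ** S2 \<or> S2 ** k = - (k ** S2)"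
    and "k ** N ** adj2 k \<in> sym_mats"
  shows "k ** N ** adj2 k = N"
proof -
  obtain A a D where N: "N = mat2 A a a D" "a > 0" using sym_matsD[OF assms(1)] by metis
  obtain A' a' D' where N': "k ** N ** adj2 k = mat2 A' a' a' D'" "a' > 0"
    using sym_matsD[OF assms(4)] by metis
  show ?thesis
    using commutes_with_S[OF assms(2,3)] N N' by (auto simp: mat_1_mat2)
qed

end

section \<open>Symmetric representatives of one class\<close>

text \<open>From here on the class of one normalized symmetric matrix is fixed. Such a matrix is hyperbolic, and
its axis in the half plane passes through the fixed point of \<open>S\<close>.\<close>

locale hecke_axis = hecke +
  fixes A a D :: real
  assumes odd_p: "odd p" and M0: "mat2 A a a D \<in> hecke_mats p" and a_pos: "a > 0"
    and tr_pos: "A + D > 0"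
begin

abbreviation "M\<^sub>0 \<equiv> mat2 A a a D"

definition cent :: "(real^2^2) set" where
  "cent = {X \<in> G. X ** M\<^sub>0 = M\<^sub>0 ** X}"

text \<open>\<open>(1, slope)\<close> is an eigenvector of \<open>M\<^sub>0\<close>, and therefore of everything that commutes with \<open>M\<^sub>0\<close>;
the next definition is the corresponding eigenvalue.\<close>

definition slope :: real where
  "slope = (D - A + sqrt ((D - A)\<^sup>2 + 4 * a\<^sup>2)) / (2 * a)"

definition eigenvalue :: "real^2^2 \<Rightarrow> real" where
  "eigenvalue X = X $ 1 $ 1 + slope * (X $ 1 $ 2)"

lemma slope: "a * slope\<^sup>2 + (A - D) * slope - a = 0"
proof -
  define r where "r = sqrt ((D - A)\<^sup>2 + 4 * a\<^sup>2)"
  have r: "r\<^sup>2 = (D - A)\<^sup>2 + 4 * a\<^sup>2" by (simp add: r_def)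
  have s: "2 * a * slope = D - A + r" using a_pos by (simp add: slope_def r_def)
  have "4 * a * (a * slope\<^sup>2 + (A - D) * slope - a)
      = (2 * a * slope)\<^sup>2 + 2 * (A - D) * (2 * a * slope) - 4 * a\<^sup>2"
    by (simp add: power2_eq_square algebra_simps)
  also have "\<dots> = 0" unfolding s using r by (simp add: power2_eq_square algebra_simps)
  finally show ?thesis using a_pos by simp
qed

lemma centD:
  assumes "X \<in> cent"
  obtains x y w where "X = mat2 x y y w" "x * w - y * y = 1" "a * (x - w) = y * (A - D)"
    "y * slope\<^sup>2 + (x - w) * slope - y = 0" "X \<in> G"
proof -
  obtain x y z w where X: "X = mat2 x y z w" by (rule mat2_cases)
  have G: "X \<in> G" using assms by (simp add: cent_def)
  have eqs: "x * A + y * a = A * x + a * z" "x * a + y * D = A * y + a * w"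
    using assms unfolding cent_def X by auto
  have "a * (y - z) = 0" using eqs(1) by (simp add: algebra_simps)
  then have "z = y" using a_pos by simp
  moreover have rel: "a * (x - w) = y * (A - D)" using eqs(2) by (simp add: algebra_simps)
  moreover have "y * slope\<^sup>2 + (x - w) * slope - y = 0"
  proof -
    have "a * (y * slope\<^sup>2 + (x - w) * slope - y)
        = y * (a * slope\<^sup>2) + (a * (x - w)) * slope - y * a"
      by (simp add: algebra_simps)
    also have "\<dots> = y * (a * slope\<^sup>2 + (A - D) * slope - a)"
      unfolding rel by (simp add: algebra_simps)
    finally show ?thesis using slope a_pos by simp
  qed
  moreover have "x * w - y * z = 1" using hecke_mats_det[OF G] X by simp
  ultimately show ?thesis using that X G by simp
qed

lemma cent_in_G: "X \<in> cent \<Longrightarrow> X \<in> G"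
  by (simp add: cent_def)

lemma cent_det: "X \<in> cent \<Longrightarrow> det X = 1"
  by (rule hecke_mats_det[OF cent_in_G])

lemma cent_M0: "M\<^sub>0 \<in> cent"
  by (simp add: cent_def M0 del: mat2_mult)

lemma cent_uminus: "X \<in> cent \<Longrightarrow> - X \<in> cent"
  by (simp add: cent_def hecke_mats_uminus)

lemma cent_mult: "X \<in> cent \<Longrightarrow> Y \<in> cent \<Longrightarrow> X ** Y \<in> cent"
  unfolding cent_def by (simp add: hecke_mats_mult) (metis matrix_mul_assoc)

lemma cent_adj: "X \<in> cent \<Longrightarrow> adj2 X \<in> cent"
proof -
  assume X: "X \<in> cent"
  have "adj2 X ** M\<^sub>0 = adj2 X ** (M\<^sub>0 ** X) ** adj2 X"
    by (simp only: matrix_mul_assoc adj2_cancel(1)[OF cent_det[OF X]])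
  also have "M\<^sub>0 ** X = X ** M\<^sub>0" using X by (simp only: cent_def mem_Collect_eq)
  also have "adj2 X ** (X ** M\<^sub>0) ** adj2 X = M\<^sub>0 ** adj2 X"
    by (simp only: adj2_cancel[OF cent_det[OF X]])
  finally show ?thesis using X by (simp add: cent_def hecke_mats_adj)
qed

lemma eigenvalue_mult:
  assumes "X \<in> cent" "Y \<in> cent"
  shows "eigenvalue (X ** Y) = eigenvalue X * eigenvalue Y"
proof -
  obtain x y w where X: "X = mat2 x y y w" by (rule centD[OF assms(1)])
  obtain x' y' w' where Y: "Y = mat2 x' y' y' w'" "y' * slope\<^sup>2 + (x' - w') * slope - y' = 0"
    by (rule centD[OF assms(2)])
  have "slope * (x * y' + y * w') + (x * x' + y * y')
      = (x + slope * y) * (x' + slope * y') - y * (y' * slope\<^sup>2 + (x' - w') * slope - y')"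
    by (simp add: power2_eq_square algebra_simps)
  then show ?thesis using X Y by (simp add: eigenvalue_def)
qed

lemma eigenvalue_one [simp]: "eigenvalue (mat 1) = 1"
  by (simp add: eigenvalue_def mat_1_mat2)

lemma eigenvalue_uminus [simp]: "eigenvalue (- X) = - eigenvalue X"
  by (cases X rule: mat2_cases) (simp add: eigenvalue_def)

lemma eigenvalue_adj:
  assumes "X \<in> cent"
  shows "eigenvalue X * eigenvalue (adj2 X) = 1"
  using eigenvalue_mult[OF assms cent_adj[OF assms]] adj2_right_inverse[OF cent_det[OF assms]]
  by simp

lemma eigenvalue_nonzero: "X \<in> cent \<Longrightarrow> eigenvalue X \<noteq> 0"
  using eigenvalue_adj[of X] by auto

lemma eigenvalue_trace:
  assumes "X \<in> cent"
  shows "trace X = eigenvalue X + eigenvalue (adj2 X)"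
proof -
  obtain x y w where "X = mat2 x y y w" by (rule centD[OF assms])
  then show ?thesis by (simp add: eigenvalue_def)
qed

text \<open>The centralizer consists of symmetric matrices. If \<open>u\<close> and \<open>v = 1/u\<close> are the eigenvalues of such a
matrix and \<open>y\<close> is its off-diagonal entry, then \<open>4 y\<^sup>2 \<le> (u - v)\<^sup>2\<close>. For \<open>1/2 < u < 2\<close> this is less
than \<open>4\<close>, so \<open>y = 0\<close> by the entry gap. Hence the eigenvalues form a discrete group.\<close>

lemma eigenvalue_gap:
  assumes "X \<in> cent" "1 / 2 < eigenvalue X" "eigenvalue X < 2"
  shows "X = mat 1"
proof -
  obtain x y w where X: "X = mat2 x y y w" "x * w - y * y = 1" "a * (x - w) = y * (A - D)" "X \<in> G"
    by (rule centD[OF assms(1)])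
  define u v where "u = eigenvalue X" and "v = eigenvalue (adj2 X)"
  have uv: "u * v = 1" "x + w = u + v"
    using eigenvalue_adj[OF assms(1)] eigenvalue_trace[OF assms(1)] X(1)
    by (simp_all add: u_def v_def)
  have u: "1 / 2 < u" "u < 2" using assms by (simp_all add: u_def)
  have "v = 1 / u" using uv(1) u by (simp add: field_simps)
  moreover have "1 / 2 < 1 / u" "1 / u < 2" using u by (simp_all add: field_simps)
  ultimately have v: "1 / 2 < v" "v < 2" by simp_all
  have "(x - w)\<^sup>2 + 4 * y\<^sup>2 = (u - v)\<^sup>2"
  proof -
    have "(x - w)\<^sup>2 + 4 * y\<^sup>2 = (x + w)\<^sup>2 - 4 * (x * w - y * y)"
      by (simp add: power2_eq_square algebra_simps)
    also have "\<dots> = (u + v)\<^sup>2 - 4 * (u * v)" using X(2) uv by simp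
    finally show ?thesis by (simp add: power2_eq_square algebra_simps)
  qed
  moreover have "(u - v)\<^sup>2 < 2\<^sup>2"
    using u v by (intro power2_strict_mono) (simp add: abs_less_iff)
  ultimately have "4 * y\<^sup>2 < 4 - (x - w)\<^sup>2" by simp
  then have "y\<^sup>2 < 1\<^sup>2" using zero_le_power2[of "x - w"] unfolding one_power2 by linarith
  then have "\<bar>y\<bar> < 1" using power2_less_imp_less[of "\<bar>y\<bar>" 1] by simp
  then have "y = 0" using G_entry_gap(2) X(1,4) by fastforce
  then have "X = mat2 x 0 0 w" "eigenvalue X = x" using X(1) by (simp_all add: eigenvalue_def)
  then show ?thesis using diagonal_in_G[of x w] X(4) assms(2) by (auto simp: mat_1_mat2)
qed

lemma eigenvalue_inj:
  assumes "X \<in> cent" "Y \<in> cent" "eigenvalue X = eigenvalue Y"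
  shows "X = Y"
proof -
  have "X ** adj2 Y = mat 1"
  proof (rule eigenvalue_gap)
    show "X ** adj2 Y \<in> cent" by (intro cent_mult cent_adj assms)
    have "eigenvalue (X ** adj2 Y) = 1"
      using eigenvalue_mult[OF assms(1) cent_adj[OF assms(2)]] eigenvalue_adj[OF assms(2)] assms(3)
      by simp
    then show "1 / 2 < eigenvalue (X ** adj2 Y)" "eigenvalue (X ** adj2 Y) < 2" by simp_all
  qed
  then show ?thesis using adj2_cancel(2)[OF cent_det[OF assms(2)], of X] by simp
qed

lemma cent_commute: "X \<in> cent \<Longrightarrow> Y \<in> cent \<Longrightarrow> X ** Y = Y ** X"
  by (rule eigenvalue_inj) (simp_all add: cent_mult eigenvalue_mult)

lemma S_cent: "X \<in> cent \<Longrightarrow> S2 ** X = adj2 X ** S2"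
  by (erule centD) (simp only: symmetric_iff_S)

text \<open>The logarithms of the positive eigenvalues form a discrete subgroup of the reals, nontrivial because of
\<open>M\<^sub>0\<close>. It is isomorphic to the centralizer modulo sign, with doubling in place of squaring.\<close>

lemma cent_mod_squares:
  obtains \<gamma> where "\<gamma> \<in> cent"
    "\<And>X. X \<in> cent \<Longrightarrow> \<exists>Z\<in>cent. X \<in> {Z ** Z, - (Z ** Z), Z ** Z ** \<gamma>, - (Z ** Z ** \<gamma>)}"
    "\<And>Z. Z \<in> cent \<Longrightarrow> \<gamma> \<noteq> Z ** Z \<and> \<gamma> \<noteq> - (Z ** Z)"
proof -
  define L where "L = {ln (eigenvalue X) | X. X \<in> cent \<and> eigenvalue X > 0}"
  have LI: "ln (eigenvalue X) \<in> L" if "X \<in> cent" "eigenvalue X > 0" for X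
    using that by (auto simp: L_def)
  have diff: "u - v \<in> L" if uv: "u \<in> L" "v \<in> L" for u v
  proof -
    obtain X Y where XY: "X \<in> cent" "eigenvalue X > 0" "u = ln (eigenvalue X)"
      "Y \<in> cent" "eigenvalue Y > 0" "v = ln (eigenvalue Y)"
      using uv unfolding L_def by blast
    have "eigenvalue (adj2 Y) = inverse (eigenvalue Y)"
      using inverse_unique[OF eigenvalue_adj[OF XY(4)]] by simp
    then have "eigenvalue (X ** adj2 Y) = eigenvalue X / eigenvalue Y"
      using eigenvalue_mult[OF XY(1) cent_adj[OF XY(4)]] by (simp add: divide_inverse)
    then show ?thesis
      using LI[of "X ** adj2 Y"] XY by (simp add: cent_mult cent_adj ln_div)
  qed
  have gap: "u \<ge> ln 2" if u: "u \<in> L" "u > 0" for u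
  proof (rule ccontr)
    assume "\<not> u \<ge> ln 2"
    obtain X where X: "X \<in> cent" "eigenvalue X > 0" "u = ln (eigenvalue X)"
      using u unfolding L_def by blast
    have "eigenvalue X > 1" "eigenvalue X < 2" using X u \<open>\<not> u \<ge> ln 2\<close> by simp_all
    then have "X = mat 1" using X by (intro eigenvalue_gap) simp_all
    then show False using X u by simp
  qed
  have posM: "eigenvalue M\<^sub>0 > 0"
  proof (rule ccontr)
    assume "\<not> eigenvalue M\<^sub>0 > 0"
    then have "eigenvalue M\<^sub>0 < 0" using eigenvalue_nonzero[OF cent_M0] by simp
    moreover from this have "eigenvalue (adj2 M\<^sub>0) < 0"
      using eigenvalue_adj[OF cent_M0] by (metis mult_neg_pos not_less_iff_gr_or_eq
          zero_less_one mult_zero_right less_asym)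
    ultimately show False using eigenvalue_trace[OF cent_M0] tr_pos by simp
  qed
  have "ln (eigenvalue M\<^sub>0) \<noteq> 0"
  proof
    assume "ln (eigenvalue M\<^sub>0) = 0"
    then have "M\<^sub>0 = mat 1" using posM by (intro eigenvalue_gap cent_M0) simp_all
    then show False using a_pos by (simp add: mat_1_mat2)
  qed
  then obtain q where q: "q \<in> L" "\<And>x. x \<in> L \<Longrightarrow> \<exists>y\<in>L. x = 2 * y \<or> x = 2 * y + q"
    "\<And>y. y \<in> L \<Longrightarrow> 2 * y \<noteq> q"
    using discrete_subgroup_index_2[of L "ln 2", OF diff _ gap LI[OF cent_M0 posM]] by auto
  obtain \<gamma> where \<gamma>: "\<gamma> \<in> cent" "eigenvalue \<gamma> > 0" "q = ln (eigenvalue \<gamma>)"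
    using q(1) unfolding L_def by blast
  show ?thesis
  proof (rule that[OF \<gamma>(1)])
    fix X assume X: "X \<in> cent"
    have pos: "\<exists>Z\<in>cent. Y \<in> {Z ** Z, Z ** Z ** \<gamma>}" if Y: "Y \<in> cent" "eigenvalue Y > 0" for Y
    proof -
      obtain Z where Z: "Z \<in> cent" "eigenvalue Z > 0"
        "ln (eigenvalue Y) = 2 * ln (eigenvalue Z) \<or>
         ln (eigenvalue Y) = 2 * ln (eigenvalue Z) + ln (eigenvalue \<gamma>)"
        using q(2)[OF LI[OF Y]] unfolding L_def \<gamma>(3)[symmetric] by blast
      have "ln (eigenvalue (Z ** Z)) = 2 * ln (eigenvalue Z)"
        "ln (eigenvalue (Z ** Z ** \<gamma>)) = 2 * ln (eigenvalue Z) + ln (eigenvalue \<gamma>)"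
        using Z \<gamma> by (simp_all add: eigenvalue_mult cent_mult ln_mult)
      moreover have "eigenvalue (Z ** Z) > 0" "eigenvalue (Z ** Z ** \<gamma>) > 0"
        using Z \<gamma> by (simp_all add: eigenvalue_mult cent_mult)
      ultimately have "eigenvalue Y = eigenvalue (Z ** Z) \<or> eigenvalue Y = eigenvalue (Z ** Z ** \<gamma>)"
        using Z(3) Y(2) by (metis ln_inj_iff)
      then have "Y = Z ** Z \<or> Y = Z ** Z ** \<gamma>"
        using Y(1) Z(1) \<gamma>(1) by (metis eigenvalue_inj cent_mult)
      with Z show ?thesis by blast
    qed
    show "\<exists>Z\<in>cent. X \<in> {Z ** Z, - (Z ** Z), Z ** Z ** \<gamma>, - (Z ** Z ** \<gamma>)}"
    proof (cases "eigenvalue X > 0")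
      case True
      then show ?thesis using pos[OF X] by blast
    next
      case False
      then have "eigenvalue (- X) > 0" using eigenvalue_nonzero[OF X] by simp
      then obtain Z where Z: "Z \<in> cent" "- X \<in> {Z ** Z, Z ** Z ** \<gamma>}"
        using pos[OF cent_uminus[OF X]] by blast
      then have "X = - (Z ** Z) \<or> X = - (Z ** Z ** \<gamma>)" by (metis insertE emptyE minus_minus)
      with Z(1) show ?thesis by blast
    qed
  next
    fix Z assume Z: "Z \<in> cent"
    have sq: "eigenvalue (Z ** Z) = \<bar>eigenvalue Z\<bar> * \<bar>eigenvalue Z\<bar>"
      using Z by (simp add: eigenvalue_mult)
    have "ln \<bar>eigenvalue Z\<bar> \<in> L"
      using LI[of Z] LI[of "- Z"] Z eigenvalue_nonzero[OF Z] cent_uminus[OF Z]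
      by (cases "eigenvalue Z > 0") simp_all
    then have "2 * ln \<bar>eigenvalue Z\<bar> \<noteq> ln (eigenvalue \<gamma>)" using q(3) \<gamma>(3) by simp
    then have "\<gamma> \<noteq> Z ** Z"
      using eigenvalue_nonzero[OF Z] ln_mult[of "\<bar>eigenvalue Z\<bar>" "\<bar>eigenvalue Z\<bar>"] by (auto simp: sq)
    moreover have "\<gamma> \<noteq> - (Z ** Z)"
    proof
      assume "\<gamma> = - (Z ** Z)"
      then have "eigenvalue \<gamma> = - (\<bar>eigenvalue Z\<bar> * \<bar>eigenvalue Z\<bar>)" using sq by simp
      then show False using \<gamma>(2) mult_nonneg_nonneg[of "\<bar>eigenvalue Z\<bar>" "\<bar>eigenvalue Z\<bar>"] by linarith
    qed
    ultimately show "\<gamma> \<noteq> Z ** Z \<and> \<gamma> \<noteq> - (Z ** Z)" ..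
  qed
qed

end

context hecke_axis
begin

lemma conj_cent:
  assumes "Z \<in> cent"
  shows "(k ** Z) ** M\<^sub>0 ** adj2 (k ** Z) = k ** M\<^sub>0 ** adj2 k"
proof -
  have "Z ** M\<^sub>0 = M\<^sub>0 ** Z" using assms by (simp only: cent_def mem_Collect_eq)
  then have "k ** (Z ** M\<^sub>0) ** adj2 Z ** adj2 k = k ** M\<^sub>0 ** adj2 k"
    by (simp only: matrix_mul_assoc adj2_cancel[OF cent_det[OF assms]])
  then show ?thesis by (simp only: adj2_mult matrix_mul_assoc)
qed

text \<open>Both \<open>S\<close> and \<open>k\<inverse> S k\<close> conjugate \<open>M\<^sub>0\<close> to its inverse, so their product commutes with \<open>M\<^sub>0\<close>.\<close>

lemma conj_intertwines:
  assumes "k \<in> G" "k ** M\<^sub>0 ** adj2 k \<in> sym_mats"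
  shows "adj2 k ** S2 ** k ** S2 \<in> cent"
proof -
  define M h where "M = k ** M\<^sub>0 ** adj2 k" and "h = adj2 k ** S2 ** k"
  have detk: "det k = 1" by (rule hecke_mats_det[OF assms(1)])
  have detM0: "det M\<^sub>0 = 1" by (rule cent_det[OF cent_M0])
  have Mk: "M ** k = k ** M\<^sub>0" by (simp only: M_def adj2_cancel[OF detk])
  obtain A' a' D' where M: "M = mat2 A' a' a' D'"
    using sym_matsD[OF assms(2)] unfolding M_def by metis
  have SM: "S2 ** M = adj2 M ** S2" unfolding M symmetric_iff_S ..
  have SM0: "S2 ** M\<^sub>0 = adj2 M\<^sub>0 ** S2" unfolding symmetric_iff_S ..
  have kM: "adj2 k ** adj2 M = adj2 M\<^sub>0 ** adj2 k"
    by (simp only: adj2_mult[symmetric] Mk)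
  have "h ** M\<^sub>0 = adj2 k ** S2 ** (k ** M\<^sub>0)" by (simp only: h_def matrix_mul_assoc)
  also have "\<dots> = adj2 k ** (S2 ** M) ** k" by (simp only: Mk[symmetric] matrix_mul_assoc)
  also have "\<dots> = (adj2 k ** adj2 M) ** S2 ** k" by (simp only: SM matrix_mul_assoc)
  also have "\<dots> = adj2 M\<^sub>0 ** h" by (simp only: kM h_def matrix_mul_assoc)
  finally have hM: "h ** M\<^sub>0 = adj2 M\<^sub>0 ** h" .
  have "h ** adj2 M\<^sub>0 = M\<^sub>0 ** (adj2 M\<^sub>0 ** h) ** adj2 M\<^sub>0"
    by (simp only: adj2_cancel[OF detM0])
  also have "\<dots> = M\<^sub>0 ** h"
    by (simp only: hM[symmetric] matrix_mul_assoc adj2_cancel(1)[OF detM0])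
  finally have hM': "h ** adj2 M\<^sub>0 = M\<^sub>0 ** h" .
  have "h ** S2 ** M\<^sub>0 = h ** (S2 ** M\<^sub>0)" by (simp only: matrix_mul_assoc)
  also have "\<dots> = (h ** adj2 M\<^sub>0) ** S2" by (simp only: SM0 matrix_mul_assoc)
  also have "\<dots> = M\<^sub>0 ** (h ** S2)" by (simp only: hM' matrix_mul_assoc)
  finally have "h ** S2 ** M\<^sub>0 = M\<^sub>0 ** (h ** S2)" .
  moreover have "h ** S2 \<in> G"
    unfolding h_def by (intro hecke_mats_mult hecke_mats_adj S2_in_hecke_mats assms)
  ultimately show ?thesis unfolding cent_def h_def by blast
qed

text \<open>Up to sign, \<open>k\<inverse> S k = \<gamma> S\<close>: the conjugation by \<open>k\<close> makes the involution \<open>\<gamma> S\<close> that inverts \<open>M\<^sub>0\<close>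
play the role of \<open>S\<close>.\<close>

definition swapped :: "real^2^2 \<Rightarrow> real^2^2 \<Rightarrow> bool" where
  "swapped \<gamma> k \<longleftrightarrow> S2 ** k = k ** \<gamma> ** S2 \<or> S2 ** k = - (k ** \<gamma> ** S2)"

lemma swapped_one: "swapped (mat 1) k \<longleftrightarrow> S2 ** k = k ** S2 \<or> S2 ** k = - (k ** S2)"
  by (simp only: swapped_def matrix_mul_rid)

text \<open>If \<open>k\<inverse> S k = X S\<close> with \<open>X = Z\<^sup>2\<close> or \<open>X = Z\<^sup>2 \<gamma>\<close> up to sign, then \<open>k Z\<close> has the desired property,
since \<open>Z\<inverse> X S Z = Z\<inverse> X Z\<inverse> S\<close> by symmetry of \<open>Z\<close>, and the centralizer is commutative.\<close>

lemma conj_representative: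
  assumes k: "k \<in> G" "k ** M\<^sub>0 ** adj2 k \<in> sym_mats"
    and \<gamma>: "\<gamma> \<in> cent"
      "\<And>X. X \<in> cent \<Longrightarrow> \<exists>Z\<in>cent. X \<in> {Z ** Z, - (Z ** Z), Z ** Z ** \<gamma>, - (Z ** Z ** \<gamma>)}"
  shows "\<exists>k'\<in>G. k' ** M\<^sub>0 ** adj2 k' = k ** M\<^sub>0 ** adj2 k \<and> (swapped (mat 1) k' \<or> swapped \<gamma> k')"
proof -
  have detk: "det k = 1" by (rule hecke_mats_det[OF k(1)])
  define Y where "Y = adj2 k ** S2 ** k ** S2"
  have "Y \<in> cent" unfolding Y_def by (rule conj_intertwines[OF k])
  then obtain Z where Z: "Z \<in> cent" "Y \<in> {Z ** Z, - (Z ** Z), Z ** Z ** \<gamma>, - (Z ** Z ** \<gamma>)}"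
    using \<gamma>(2) by blast
  have detZ: "det Z = 1" by (rule cent_det[OF Z(1)])
  have "k ** Y = S2 ** k ** S2"
    by (simp only: Y_def matrix_mul_assoc adj2_right_inverse[OF detk] matrix_mul_lid)
  then have "k ** Y ** S2 = - (S2 ** k)"
    by (cases k rule: mat2_cases) simp
  then have Sk: "S2 ** k = - (k ** Y ** S2)" by (metis minus_minus)
  define Q where "Q = Y ** adj2 Z"
  have key: "S2 ** (k ** Z) = - (k ** Q ** S2)"
  proof -
    have "S2 ** (k ** Z) = (S2 ** k) ** Z" by (simp only: matrix_mul_assoc)
    also have "\<dots> = - (k ** Y ** (S2 ** Z))" by (simp only: Sk matrix_neg_left matrix_mul_assoc)
    also have "\<dots> = - (k ** Q ** S2)"
      by (simp only: S_cent[OF Z(1)] Q_def matrix_mul_assoc)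
    finally show ?thesis .
  qed
  have Z1: "Z ** Z ** adj2 Z = Z" by (rule adj2_cancel(1)[OF detZ])
  have "Z ** Z ** \<gamma> ** adj2 Z = Z ** (Z ** \<gamma>) ** adj2 Z" by (simp only: matrix_mul_assoc)
  also have "\<dots> = Z ** \<gamma>"
    by (simp only: cent_commute[OF Z(1) \<gamma>(1)] matrix_mul_assoc adj2_cancel(1)[OF detZ])
  finally have Z2: "Z ** Z ** \<gamma> ** adj2 Z = Z ** \<gamma>" .
  have "Q \<in> {Z, - Z, Z ** \<gamma>, - (Z ** \<gamma>)}"
    using Z(2) Z1 Z2 unfolding Q_def by (auto simp only: matrix_neg_left insert_iff empty_iff)
  then have "swapped (mat 1) (k ** Z) \<or> swapped \<gamma> (k ** Z)"
    unfolding swapped_def key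
    by (auto simp only: insert_iff empty_iff matrix_neg_left matrix_neg_right matrix_mul_assoc
        matrix_mul_rid minus_minus)
  moreover have "k ** Z \<in> G" by (intro hecke_mats_mult k cent_in_G Z)
  ultimately show ?thesis using conj_cent[OF Z(1)] by blast
qed

text \<open>Both \<open>k\<close> and \<open>l\<close> conjugate \<open>\<gamma> S\<close> to \<open>\<plusminus> S\<close>, so \<open>l k\<inverse>\<close> conjugates \<open>S\<close> to \<open>\<plusminus> S\<close>.\<close>

lemma swapped_ratio:
  assumes "k \<in> G" "l \<in> G" "\<gamma> \<in> G" "swapped \<gamma> k" "swapped \<gamma> l"
  shows "swapped (mat 1) (l ** adj2 k)"
proof -
  have detk: "det k = 1" and detg: "det \<gamma> = 1" using assms hecke_mats_det by auto
  define W where "W = \<gamma> ** S2"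
  have k: "S2 ** k = k ** W \<or> S2 ** k = - (k ** W)"
    and l: "S2 ** l = l ** W \<or> S2 ** l = - (l ** W)"
    using assms(4,5) by (simp_all only: swapped_def W_def matrix_mul_assoc)
  have e1: "W ** adj2 k = adj2 k ** (k ** W) ** adj2 k" by (simp only: adj2_cancel[OF detk])
  have e2: "adj2 k ** (S2 ** k) ** adj2 k = adj2 k ** S2"
    by (simp only: matrix_mul_assoc adj2_cancel(1)[OF detk])
  from k have "k ** W = S2 ** k \<or> k ** W = - (S2 ** k)" by auto
  then have W: "W ** adj2 k = adj2 k ** S2 \<or> W ** adj2 k = - (adj2 k ** S2)"
    unfolding e1 by (elim disjE) (simp_all only: matrix_neg_left matrix_neg_right e2 simp_thms)
  from l have "S2 ** l ** adj2 k = l ** (W ** adj2 k) \<or> S2 ** l ** adj2 k = - (l ** (W ** adj2 k))"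
    by (elim disjE) (simp_all only: matrix_neg_left matrix_mul_assoc simp_thms)
  with W have "S2 ** l ** adj2 k = l ** (adj2 k ** S2) \<or> S2 ** l ** adj2 k = - (l ** (adj2 k ** S2))"
    by (elim disjE) (simp_all only: matrix_neg_right minus_minus simp_thms)
  then show ?thesis
    unfolding swapped_one by (simp only: matrix_mul_assoc)
qed

lemma swapped_same_conj:
  assumes "k \<in> G" "l \<in> G" "\<gamma> \<in> G" "swapped \<gamma> k" "swapped \<gamma> l"
    and "k ** M\<^sub>0 ** adj2 k \<in> sym_mats" "l ** M\<^sub>0 ** adj2 l \<in> sym_mats"
  shows "l ** M\<^sub>0 ** adj2 l = k ** M\<^sub>0 ** adj2 k"
proof -
  have detk: "det k = 1" by (rule hecke_mats_det[OF assms(1)])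
  define n where "n = l ** adj2 k"
  have eq: "n ** (k ** M\<^sub>0 ** adj2 k) ** adj2 n = l ** M\<^sub>0 ** adj2 l"
    by (simp only: n_def adj2_mult adj2_adj2 matrix_mul_assoc adj2_cancel(2)[OF detk])
  have "n \<in> G" unfolding n_def by (intro hecke_mats_mult hecke_mats_adj assms)
  moreover have "swapped (mat 1) n" unfolding n_def by (rule swapped_ratio[OF assms(1-5)])
  ultimately show ?thesis
    using sym_mats_conj_rigid[OF assms(6), of n] assms(7) unfolding eq swapped_one by blast
qed

lemma M0_sym: "M\<^sub>0 \<in> sym_mats"
  using M0 a_pos tr_pos by (auto simp: sym_mats_def)

text \<open>The two square classes of the centralizer give at most one matrix each. The trivial class gives \<open>M\<^sub>0\<close>.
For the other class, \<open>\<gamma> S\<close> is an element of \<open>G\<close> of trace \<open>0\<close>, hence conjugate to \<open>S\<close>, and the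
conjugating matrix yields the second symmetric matrix. Were the two equal, \<open>\<gamma>\<close> would be a square up to
sign.\<close>

theorem two_symmetric_conjugates:
  "\<exists>M\<in>sym_mats. M \<noteq> M\<^sub>0 \<and>
     {N \<in> sym_mats. \<exists>k\<in>G. N = k ** M\<^sub>0 ** adj2 k} = {M\<^sub>0, M}"
proof -
  obtain \<gamma> where \<gamma>: "\<gamma> \<in> cent"
    "\<And>X. X \<in> cent \<Longrightarrow> \<exists>Z\<in>cent. X \<in> {Z ** Z, - (Z ** Z), Z ** Z ** \<gamma>, - (Z ** Z ** \<gamma>)}"
    "\<And>Z. Z \<in> cent \<Longrightarrow> \<gamma> \<noteq> Z ** Z \<and> \<gamma> \<noteq> - (Z ** Z)"
    using cent_mod_squares by blast
  have \<gamma>G: "\<gamma> \<in> G" by (rule cent_in_G[OF \<gamma>(1)])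
  have "trace (\<gamma> ** S2) = 0" by (rule centD[OF \<gamma>(1)]) simp
  moreover have "\<gamma> ** S2 \<in> G" by (intro hecke_mats_mult \<gamma>G S2_in_hecke_mats)
  ultimately obtain X where X: "X \<in> G"
    "\<gamma> ** S2 = X ** S2 ** adj2 X \<or> \<gamma> ** S2 = - (X ** S2 ** adj2 X)"
    using involution_conj_S[OF odd_p] by blast
  have detX: "det X = 1" by (rule hecke_mats_det[OF X(1)])
  define k where "k = adj2 X"
  have k: "k \<in> G" unfolding k_def by (rule hecke_mats_adj[OF X(1)])
  have detk: "det k = 1" by (rule hecke_mats_det[OF k])
  have "adj2 X ** (X ** S2 ** adj2 X) = S2 ** adj2 X"
    by (simp only: matrix_mul_assoc adj2_left_inverse[OF detX] matrix_mul_lid)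
  then have "k ** (\<gamma> ** S2) = S2 ** k \<or> k ** (\<gamma> ** S2) = - (S2 ** k)"
    using X(2) unfolding k_def by (auto simp only: matrix_neg_right)
  then have sw: "swapped \<gamma> k"
    unfolding swapped_def by (metis matrix_mul_assoc minus_minus)
  define N where "N = k ** M\<^sub>0 ** adj2 k"
  have NG: "N \<in> G" unfolding N_def by (intro hecke_mats_mult hecke_mats_adj k M0)
  have trN: "trace N = A + D" unfolding N_def trace_conj[OF detk] by simp
  \<comment> \<open>\<open>S\<close> inverts \<open>N\<close> because \<open>\<gamma> S\<close> inverts \<open>M\<^sub>0\<close>.\<close>
  have SN: "S2 ** N = adj2 N ** S2"
  proof -
    define W where "W = \<gamma> ** S2"
    have W: "S2 ** k = k ** W \<or> S2 ** k = - (k ** W)"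
      using sw by (simp only: swapped_def W_def matrix_mul_assoc)
    have "W ** M\<^sub>0 = \<gamma> ** (S2 ** M\<^sub>0)" by (simp only: W_def matrix_mul_assoc)
    also have "\<dots> = (\<gamma> ** adj2 M\<^sub>0) ** S2" by (simp only: S_cent[OF cent_M0] matrix_mul_assoc)
    also have "\<dots> = adj2 M\<^sub>0 ** W"
      by (simp only: cent_commute[OF \<gamma>(1) cent_adj[OF cent_M0]] W_def matrix_mul_assoc)
    finally have WM: "W ** M\<^sub>0 = adj2 M\<^sub>0 ** W" .
    have adjN: "adj2 N = k ** adj2 M\<^sub>0 ** adj2 k"
      by (simp only: N_def adj2_mult adj2_adj2 matrix_mul_assoc)
    have "k ** W ** M\<^sub>0 ** adj2 k = k ** (W ** M\<^sub>0) ** adj2 k" by (simp only: matrix_mul_assoc)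
    also have "\<dots> = k ** adj2 M\<^sub>0 ** (adj2 k ** k) ** W ** adj2 k"
      by (simp only: WM adj2_left_inverse[OF detk] matrix_mul_rid matrix_mul_assoc)
    finally have kW: "k ** W ** M\<^sub>0 ** adj2 k = adj2 N ** (k ** W) ** adj2 k"
      by (simp only: adjN matrix_mul_assoc)
    have "S2 ** N = (S2 ** k) ** M\<^sub>0 ** adj2 k" by (simp only: N_def matrix_mul_assoc)
    also have "\<dots> = adj2 N ** (S2 ** k) ** adj2 k"
      using W kW by (auto simp only: matrix_neg_left matrix_neg_right)
    also have "\<dots> = adj2 N ** S2"
      by (simp only: matrix_mul_assoc adj2_cancel(1)[OF detk])
    finally show ?thesis .
  qed
  obtain A' b c D' where "N = mat2 A' b c D'" by (rule mat2_cases)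
  then have N: "N = mat2 A' b b D'" using SN by (simp only: symmetric_iff_S)
  have M0N: "M\<^sub>0 = adj2 k ** N ** k"
    unfolding N_def by (simp only: matrix_mul_assoc adj2_left_inverse[OF detk] matrix_mul_lid
        adj2_cancel(2)[OF detk])
  have "b \<noteq> 0"
  proof
    assume "b = 0"
    then have "N = mat 1 \<or> N = - mat 1"
      using diagonal_in_G[of A' D'] NG N by (auto simp: mat_1_mat2)
    then have "M\<^sub>0 = mat 1 \<or> M\<^sub>0 = - mat 1"
      unfolding M0N by (auto simp only: matrix_neg_left matrix_neg_right matrix_mul_rid
          adj2_left_inverse[OF detk])
    then show False using a_pos by (auto simp: mat_1_mat2)
  qed
  moreover have "A' + D' > 0" using trN tr_pos unfolding N by simp
  ultimately obtain Y where Y: "Y \<in> {mat 1, S2}" "Y ** N ** adj2 Y \<in> sym_mats"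
    using normalize_symmetric[of A' b D'] NG unfolding N by blast
  define l where "l = Y ** k"
  have "Y \<in> G" using Y(1) hecke_mats_one S2_in_hecke_mats by (elim insertE emptyE) simp_all
  then have l: "l \<in> G" unfolding l_def by (intro hecke_mats_mult k)
  have detl: "det l = 1" by (rule hecke_mats_det[OF l])
  have "S2 ** Y = Y ** S2" using Y(1) by (elim insertE emptyE) (simp_all only: matrix_mul_lid matrix_mul_rid)
  then have "S2 ** l = Y ** (S2 ** k)" by (simp only: l_def matrix_mul_assoc)
  with sw have "S2 ** l = Y ** (k ** \<gamma> ** S2) \<or> S2 ** l = - (Y ** (k ** \<gamma> ** S2))"
    unfolding swapped_def by (elim disjE) (simp_all only: matrix_neg_right simp_thms)
  then have swl: "swapped \<gamma> l"
    unfolding swapped_def l_def by (simp only: matrix_mul_assoc)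
  define M where "M = l ** M\<^sub>0 ** adj2 l"
  have "M = Y ** N ** adj2 Y"
    by (simp only: M_def l_def N_def adj2_mult matrix_mul_assoc)
  then have M: "M \<in> sym_mats" using Y(2) by simp
  have "M \<noteq> M\<^sub>0"
  proof
    assume "M = M\<^sub>0"
    then have "l ** M\<^sub>0 = M\<^sub>0 ** l"
      using adj2_cancel(2)[OF detl, of "l ** M\<^sub>0"] unfolding M_def by simp
    then have lc: "l \<in> cent" using l unfolding cent_def by simp
    have "S2 ** l = adj2 l ** S2" by (rule S_cent[OF lc])
    with swl have "adj2 l ** S2 = l ** \<gamma> ** S2 \<or> adj2 l ** S2 = - (l ** \<gamma>) ** S2"
      unfolding swapped_def by (simp only: matrix_neg_left)
    moreover have "det S2 = 1" by simp
    ultimately have "adj2 l = l ** \<gamma> \<or> adj2 l = - (l ** \<gamma>)"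
      using adj2_cancel(1)[of S2] by metis
    then have "adj2 l ** adj2 l = \<gamma> \<or> adj2 l ** adj2 l = - \<gamma>"
      using adj2_cancel(4)[OF detl, of \<gamma>] by (metis matrix_neg_right)
    then show False using \<gamma>(3)[OF cent_adj[OF lc]] by auto
  qed
  moreover have "N' = M\<^sub>0 \<or> N' = M" if N': "N' \<in> sym_mats" "n \<in> G" "N' = n ** M\<^sub>0 ** adj2 n" for N' n
  proof -
    obtain n' where n': "n' \<in> G" "n' ** M\<^sub>0 ** adj2 n' = N'"
      "swapped (mat 1) n' \<or> swapped \<gamma> n'"
      using conj_representative[OF N'(2) _ \<gamma>(1,2)] N'(1,3) by metis
    from n'(3) show ?thesis
    proof
      assume "swapped (mat 1) n'"
      then have "N' = M\<^sub>0"
        using sym_mats_conj_rigid[OF M0_sym n'(1)] n'(2) N'(1) unfolding swapped_one by simp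
      then show ?thesis ..
    next
      assume "swapped \<gamma> n'"
      then have "N' = M"
        using swapped_same_conj[OF l n'(1) \<gamma>G swl] M N'(1) unfolding n'(2) M_def by blast
      then show ?thesis ..
    qed
  qed
  moreover have "M\<^sub>0 = mat 1 ** M\<^sub>0 ** adj2 (mat 1)" by (simp only: adj2_one matrix_mul_lid matrix_mul_rid)
  ultimately show ?thesis
    using M M0_sym l hecke_mats_one by (intro bexI[of _ M]) (auto simp only: M_def mem_Collect_eq insert_iff empty_iff)
qed

end

section \<open>Triples and reciprocal classes\<close>

lemma Z_lambda_add:
  assumes "x \<in> Z_lambda p" "y \<in> Z_lambda p"
  shows "x + y \<in> Z_lambda p"
proof -
  obtain f g :: "int poly" where fg: "x = poly (map_poly of_int f) (hecke_lambda p)"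
    "y = poly (map_poly of_int g) (hecke_lambda p)"
    using assms unfolding Z_lambda_def by blast
  have "map_poly of_int (f + g) = (map_poly of_int f + map_poly of_int g :: real poly)"
    by (intro poly_eqI) (simp add: coeff_map_poly)
  then have "x + y = poly (map_poly of_int (f + g)) (hecke_lambda p)" by (simp add: fg)
  then show ?thesis unfolding Z_lambda_def by blast
qed

lemma Z_lambda_mult:
  assumes "x \<in> Z_lambda p" "y \<in> Z_lambda p"
  shows "x * y \<in> Z_lambda p"
proof -
  obtain f g :: "int poly" where fg: "x = poly (map_poly of_int f) (hecke_lambda p)"
    "y = poly (map_poly of_int g) (hecke_lambda p)"
    using assms unfolding Z_lambda_def by blast
  have "map_poly of_int (f * g) = (map_poly of_int f * map_poly of_int g :: real poly)"
    by (intro poly_eqI) (simp add: coeff_map_poly coeff_mult)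
  then have "x * y = poly (map_poly of_int (f * g)) (hecke_lambda p)" by (simp add: fg)
  then show ?thesis unfolding Z_lambda_def by blast
qed

lemma Z_lambda_of_int: "of_int n \<in> Z_lambda p"
proof -
  have "of_int n = poly (map_poly of_int [:n:]) (hecke_lambda p)" by (simp add: map_poly_pCons)
  then show ?thesis unfolding Z_lambda_def by blast
qed

lemma Z_lambda_lambda: "hecke_lambda p \<in> Z_lambda p"
proof -
  have "hecke_lambda p = poly (map_poly of_int [:0, 1 :: int:]) (hecke_lambda p)"
    by (simp add: map_poly_pCons)
  then show ?thesis unfolding Z_lambda_def by blast
qed

lemma Z_lambda_uminus: "x \<in> Z_lambda p \<Longrightarrow> - x \<in> Z_lambda p"
  using Z_lambda_mult[OF Z_lambda_of_int[of "- 1"]] by simp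

lemma hecke_mats_entries:
  assumes "X \<in> hecke_mats p"
  shows "X $ i $ j \<in> Z_lambda p"
proof -
  have 01: "0 \<in> Z_lambda p" "1 \<in> Z_lambda p" "- 1 \<in> Z_lambda p"
    using Z_lambda_of_int[of 0] Z_lambda_of_int[of 1] Z_lambda_of_int[of "- 1"] by simp_all
  have "\<forall>i j. X $ i $ j \<in> Z_lambda p"
    using assms
  proof (induction rule: hecke_mats_induct)
    case (mult A B)
    then show ?case
      by (simp add: matrix_matrix_mult_def sum_2 Z_lambda_add Z_lambda_mult)
  qed (simp_all add: 01 forall_2 Z_lambda_lambda Z_lambda_uminus mat_1_mat2)
  then show ?thesis by blast
qed

definition triple_mat :: "real \<times> real \<times> real \<Rightarrow> real^2^2" where
  "triple_mat = (\<lambda>(a, b, t). mat2 ((t - b) / 2) a a ((t + b) / 2))"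

definition mat_triple :: "real^2^2 \<Rightarrow> real \<times> real \<times> real" where
  "mat_triple M = (M $ 1 $ 2, M $ 2 $ 2 - M $ 1 $ 1, M $ 1 $ 1 + M $ 2 $ 2)"

lemma mat_triple_triple_mat: "mat_triple (triple_mat x) = x"
  by (cases x) (simp add: mat_triple_def triple_mat_def field_simps)

lemma triple_mat_mat_triple: "triple_mat (mat_triple (mat2 A a a D)) = mat2 A a a D"
  by (simp add: mat_triple_def triple_mat_def)

context hecke
begin

text \<open>The equation \<open>t\<^sup>2 - d = 4\<close> says that the determinant is \<open>1\<close>, and the entries of a matrix in \<open>G\<close> lie in
\<open>\<int>[\<lambda>\<^sub>p]\<close> automatically.\<close>

lemma reciprocal_triples_iff: "x \<in> reciprocal_triples p \<longleftrightarrow> triple_mat x \<in> sym_mats"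
proof -
  obtain a b t where x: "x = (a, b, t)" by (cases x)
  define A D where "A = (t - b) / 2" and "D = (t + b) / 2"
  have bt: "b = D + - A" "t = A + D" by (simp_all add: A_def D_def field_simps)
  have sym: "triple_mat x \<in> sym_mats \<longleftrightarrow> mat2 A a a D \<in> G \<and> a > 0 \<and> t > 0"
  proof -
    have "triple_mat x = mat2 A a a D" by (simp add: triple_mat_def x A_def D_def)
    then show ?thesis unfolding bt(2) by (auto simp: sym_mats_def)
  qed
  have det: "t\<^sup>2 - (4 * a\<^sup>2 + b\<^sup>2) = 4 \<longleftrightarrow> A * D - a\<^sup>2 = 1"
    unfolding bt by (auto simp: power2_eq_square algebra_simps)
  have entries: "a \<in> Z_lambda p \<and> b \<in> Z_lambda p \<and> t \<in> Z_lambda p \<and> A \<in> Z_lambda p \<and> D \<in> Z_lambda p"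
    if "mat2 A a a D \<in> G"
    using hecke_mats_entries[OF that, of 1 1] hecke_mats_entries[OF that, of 1 2]
      hecke_mats_entries[OF that, of 2 2]
    unfolding bt by (simp add: Z_lambda_add Z_lambda_uminus del: add_uminus_conv_diff)
  have "A * D - a\<^sup>2 = 1" if "mat2 A a a D \<in> G"
    using hecke_mats_det[OF that] by (simp add: power2_eq_square)
  with symmetric_in_G_iff[of A D a] entries det show ?thesis
    unfolding sym by (auto simp: reciprocal_triples_def x A_def[symmetric] D_def[symmetric])
qed

lemma sym_mats_triple: "M \<in> sym_mats \<Longrightarrow> mat_triple M \<in> reciprocal_triples p \<and> triple_mat (mat_triple M) = M"
  by (metis reciprocal_triples_iff sym_matsD triple_mat_mat_triple)

lemma sym_mats_trace: "M \<in> sym_mats \<Longrightarrow> trace M > 0"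
  by (auto elim!: sym_matsD)

abbreviation "hecke_class M \<equiv> conj_class (Hecke p) (psl M)"

text \<open>Positivity of the traces removes the sign ambiguity of \<open>PSL(2,\<real>)\<close>.\<close>

lemma sym_mats_class_eq_iff:
  assumes "M \<in> sym_mats" "N \<in> sym_mats"
  shows "hecke_class M = hecke_class N \<longleftrightarrow> (\<exists>k\<in>G. M = k ** N ** adj2 k)"
proof -
  have "M \<noteq> - (k ** N ** adj2 k)" if k: "k \<in> G" for k
  proof
    assume "M = - (k ** N ** adj2 k)"
    then have "trace M = - trace (k ** N ** adj2 k)"
      by (cases "k ** N ** adj2 k" rule: mat2_cases) simp
    then show False
      using trace_conj[OF hecke_mats_det[OF k], of N] sym_mats_trace[OF assms(1)]
        sym_mats_trace[OF assms(2)] by simp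
  qed
  then show ?thesis
    using conj_class_psl_eq_iff[OF sym_mats_in_G sym_mats_in_G, OF assms] by blast
qed

lemma sym_mats_reciprocal:
  assumes "M \<in> sym_mats"
  shows "hecke_class M \<in> reciprocal_classes p"
proof -
  obtain A a D where M: "M = mat2 A a a D" "M \<in> G" "a > 0" "A + D > 0"
    by (rule sym_matsD[OF assms])
  have "S2 ** M ** adj2 S2 = adj2 M" unfolding M by simp
  then have "inv\<^bsub>Hecke p\<^esub> psl M = psl S2 \<otimes>\<^bsub>Hecke p\<^esub> psl M \<otimes>\<^bsub>Hecke p\<^esub> inv\<^bsub>Hecke p\<^esub> psl S2"
    using M(2) by (simp only: Hecke_conj[OF M(2) S2_in_hecke_mats] Hecke_inv)
  then have rec: "reciprocal (Hecke p) (psl M)"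
    using M(2) S2_in_hecke_mats unfolding reciprocal_def Hecke_carrier by blast
  have "a * (A + D) > 0" using M by simp
  then have "A * a + a * D \<noteq> 0" by (simp add: algebra_simps)
  then have "psl (M ** M) \<noteq> psl (mat 1)" unfolding M psl_eq_iff by (simp add: mat_1_mat2)
  then have "\<not> involution (Hecke p) (psl M)"
    using M(2) unfolding involution_def by (simp add: Hecke_mult Hecke_one)
  with rec show ?thesis unfolding reciprocal_classes_def by blast
qed

lemma reciprocal_class_symmetric:
  assumes "odd p" "c \<in> reciprocal_classes p"
  obtains M where "M \<in> sym_mats" "c = hecke_class M"
proof -
  obtain g' where c: "c = conj_class (Hecke p) g'" "reciprocal (Hecke p) g'"
    "\<not> involution (Hecke p) g'"
    using assms(2) unfolding reciprocal_classes_def by blast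
  then obtain g h where g: "g' = psl g" "g \<in> G" and h: "h \<in> G"
    "inv\<^bsub>Hecke p\<^esub> psl g = psl h \<otimes>\<^bsub>Hecke p\<^esub> psl g \<otimes>\<^bsub>Hecke p\<^esub> inv\<^bsub>Hecke p\<^esub> psl h"
    unfolding reciprocal_def Hecke_carrier by blast
  have "psl (h ** g ** adj2 h) = psl (adj2 g)"
    using h(2) by (simp only: Hecke_conj[OF g(2) h(1)] Hecke_inv[OF g(2)])
  moreover have "psl (g ** g) \<noteq> psl (mat 1)"
    using c(3) g unfolding involution_def Hecke_carrier by (auto simp: Hecke_mult Hecke_one)
  ultimately obtain X M where X: "X \<in> G" "M \<in> sym_mats"
    "M = X ** g ** adj2 X \<or> M = - (X ** g ** adj2 X)"
    using reciprocal_conj_symmetric[OF assms(1) g(2) h(1)] by blast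
  then have "hecke_class M = hecke_class g"
    using conj_class_psl_eq_iff[OF sym_mats_in_G[OF X(2)] g(2)] by blast
  then show ?thesis using that X(2) c(1) g(1) by simp
qed

lemma card_fibre:
  assumes "odd p" "c \<in> reciprocal_classes p"
  shows "card {x \<in> reciprocal_triples p. hecke_class (triple_mat x) = c} = 2"
proof -
  obtain M where M: "M \<in> sym_mats" "c = hecke_class M"
    by (rule reciprocal_class_symmetric[OF assms])
  obtain A a D where M': "M = mat2 A a a D" "M \<in> G" "a > 0" "A + D > 0"
    by (rule sym_matsD[OF M(1)])
  interpret hecke_axis p A a D
    by unfold_locales (use assms M' in auto)
  obtain N where N: "N \<in> sym_mats" "N \<noteq> M"
    "{N \<in> sym_mats. \<exists>k\<in>G. N = k ** M ** adj2 k} = {M, N}"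
    using two_symmetric_conjugates unfolding M'(1)[symmetric] by blast
  have "{x \<in> reciprocal_triples p. hecke_class (triple_mat x) = c}
      = mat_triple ` {N \<in> sym_mats. hecke_class N = c}"
    using reciprocal_triples_iff mat_triple_triple_mat sym_mats_triple
    by (auto simp: image_iff) (metis)+
  also have "{N \<in> sym_mats. hecke_class N = c} = {M, N}"
    using N(3) sym_mats_class_eq_iff[OF _ M(1)] unfolding M(2) by auto
  finally have "{x \<in> reciprocal_triples p. hecke_class (triple_mat x) = c}
      = {mat_triple M, mat_triple N}" by simp
  moreover have "mat_triple M \<noteq> mat_triple N"
    using N(1,2) M(1) sym_mats_triple by metis
  ultimately show ?thesis by simp
qed

end

theorem corollary1p9:
  fixes p :: nat
  assumes "p \<ge> 3" and "odd p"
  shows "\<exists>\<phi> \<in> reciprocal_triples p \<rightarrow> reciprocal_classes p.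
           (\<forall>(a, b, t) \<in> reciprocal_triples p.
              \<phi> (a, b, t) = conj_class (Hecke p) (psl (mat2 ((t - b) / 2) a a ((t + b) / 2)))) \<and>
           (\<forall>c \<in> reciprocal_classes p. card {x \<in> reciprocal_triples p. \<phi> x = c} = 2)"
proof -
  interpret hecke p by unfold_locales (rule assms(1))
  define \<phi> where "\<phi> x = hecke_class (triple_mat x)" for x
  have "\<phi> \<in> reciprocal_triples p \<rightarrow> reciprocal_classes p"
    unfolding \<phi>_def by (auto intro: sym_mats_reciprocal simp only: reciprocal_triples_iff)
  moreover have "\<forall>(a, b, t) \<in> reciprocal_triples p.
      \<phi> (a, b, t) = conj_class (Hecke p) (psl (mat2 ((t - b) / 2) a a ((t + b) / 2)))"
    by (auto simp: \<phi>_def triple_mat_def)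
  moreover have "\<forall>c \<in> reciprocal_classes p. card {x \<in> reciprocal_triples p. \<phi> x = c} = 2"
    unfolding \<phi>_def using card_fibre[OF assms(2)] by blast
  ultimately show ?thesis by blast
qed

end
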